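(* Let $p\leqslant n$ be positive integers, let $X_p$ be an isotropic random vector in $\mathbb{R}^p$, and suppose $p/n\leqslant y$ for some $y\in(0,1)$. Let $\mathbf{X}_{pn}$ be a random $p\times n$ matrix with independent columns each distributed as $X_p$. Then, for every $a>0$, there is a random variable $Z=Z(p,n,a)$ (on the same probability space as $\mathbf{X}_{pn}$) with $\mathbb{E}Z=0$ and $\mathbb{P}(Z<-t)\leqslant e^{-t^2/2}$ for all $t>0$, such that, almost surely, \[\lambda_p\big(n^{-1}\mathbf{X}_{pn}\mathbf{X}_{pn}^\top\big)\geqslant c_p(a)-\frac{C_p(a)}{a}-5ay+\frac{\sqrt{C_p(2a)}\,Z}{\sqrt{n}}.\]
   Context: A random vector $X_p$ in $\mathbb{R}^p$ is called isotropic if $\mathbb{E}X_pX_p^\top=I_p$, the $p\times p$ identity matrix (no centring is required). $\lambda_p(A)$ denotes the smallest eigenvalue of a symmetric $p\times p$ matrix $A$. $(\cdot,\cdot)$ is the Euclidean inner product and $\|\cdot\|$ the Euclidean norm. For $a>0$, \[c_p(a)=\inf_{\|v\|=1}\mathbb{E}\min\{(X_p,v)^2,a\},\qquad C_p(a)=\sup_{\|v\|=1}\mathbb{E}(X_p,v)^2\min\{(X_p,v)^2,a\},\] where the infimum and supremum are over $v\in\mathbb{R}^p$ with $\|v\|=1$. *)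

theory Defs
  imports "HOL-Probability.Probability"
begin

definition is_eigenvalue :: "real^'p^'p \<Rightarrow> real \<Rightarrow> bool" where
  "is_eigenvalue A l \<longleftrightarrow> (\<exists>v. v \<noteq> 0 \<and> A *v v = l *\<^sub>R v)"

text \<open>Meaningful for symmetric matrices only: these have a nonempty finite set of real
  eigenvalues, so that the least one exists.\<close>

definition smallest_eigenvalue :: "real^'p^'p \<Rightarrow> real" where
  "smallest_eigenvalue A = (LEAST l. is_eigenvalue A l)"

definition outer_product :: "real^'p \<Rightarrow> real^'p \<Rightarrow> real^'p^'p" where
  "outer_product u v = (\<chi> i j. u $ i * v $ j)"

definition isotropic :: "'b measure \<Rightarrow> ('b \<Rightarrow> real^'p) \<Rightarrow> bool" where
  "isotropic N X \<longleftrightarrow>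
     integrable N (\<lambda>\<omega>. outer_product (X \<omega>) (X \<omega>)) \<and>
     (\<integral>\<omega>. outer_product (X \<omega>) (X \<omega>) \<partial>N) = mat 1"

text \<open>For an isotropic random vector and \<open>a > 0\<close>, the expectations below are finite and lie in
  \<open>[0, a]\<close>, so the infimum and the supremum over the unit sphere are genuine.\<close>

definition lower_trunc :: "'b measure \<Rightarrow> ('b \<Rightarrow> real^'p) \<Rightarrow> real \<Rightarrow> real" where
  "lower_trunc N X a =
     (INF v\<in>{v. norm v = 1}. \<integral>\<omega>. min ((X \<omega> \<bullet> v)\<^sup>2) a \<partial>N)"

definition upper_trunc :: "'b measure \<Rightarrow> ('b \<Rightarrow> real^'p) \<Rightarrow> real \<Rightarrow> real" where
  "upper_trunc N X a =
     (SUP v\<in>{v. norm v = 1}. \<integral>\<omega>. (X \<omega> \<bullet> v)\<^sup>2 * min ((X \<omega> \<bullet> v)\<^sup>2) a \<partial>N)"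

end

theory Submission
  imports Defs
begin

text \<open>
  The columns \<open>x\<^sub>0, \<dots>, x\<^sub>n\<^sub>-\<^sub>1\<close> are added one at a time, and a real number \<open>\<ell>\<^sub>k\<close> that stays below the
  spectrum of \<open>A\<^sub>k = \<Sum>\<^bsub>j<k\<^esub> x\<^sub>j x\<^sub>j\<^sup>T\<close> is moved upwards along the way (the barrier method of Batson,
  Spielman and Srivastava). The state is \<open>B\<^sub>k = A\<^sub>k - \<ell>\<^sub>k I\<close>; it is kept positive definite with
  \<open>tr B\<^sub>k\<^sup>-\<^sup>1 \<le> \<phi>\<close>, where \<open>\<phi> = 1 / (5a)\<close>. The start \<open>\<ell>\<^sub>0 = - p / \<phi> = - 5ap\<close> gives trace exactly \<open>\<phi>\<close>, and
  after division by \<open>n\<close> it costs the term \<open>5ay\<close>.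

  Moving the barrier by \<open>d\<close> raises the trace of the inverse, adding \<open>x x\<^sup>T\<close> lowers it. With
  \<open>G = B\<^sup>-\<^sup>1\<close>, \<open>q = x\<^sup>T G x\<close> and \<open>R = |G x|\<^sup>2 / tr G\<^sup>2\<close>, the Sherman--Morrison formula shows that the
  trace does not increase for \<open>d = max 0 (t (1 - \<phi> t - q))\<close> with \<open>t = min R a\<close>
  (\<open>barrier_preserved\<close>). This step is deterministic, so after \<open>n\<close> columns the smallest eigenvalue
  of \<open>A\<^sub>n\<close> is at least the sum of the shifts minus \<open>5ap\<close> (\<open>smallest_eigenvalue_ge_shifts\<close>).

  Both \<open>R\<close> and \<open>q / tr G\<close> are convex combinations of squares \<open>(x, v)\<^sup>2\<close> with \<open>|v| = 1\<close>. Concavity of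
  \<open>min\<close> gives \<open>E t \<ge> c\<^sub>p(a)\<close>. The quadratic quantities \<open>t\<^sup>2\<close> and \<open>t q\<close> are bounded through
  Huber's function \<open>h\<close>, which is convex and satisfies both \<open>h(s) \<le> 2 s min s a\<close> and
  \<open>h(s) \<le> s min s (2a)\<close>; this is how the level \<open>2a\<close> enters. Hence the mean shift is at
  least \<open>c\<^sub>p(a) - 4 \<phi> C\<^sub>p(a) \<ge> c\<^sub>p(a) - C\<^sub>p(a) / a\<close> whatever the past (\<open>barrier_shift_mean\<close>), and its second
  moment is at most \<open>C\<^sub>p(2a)\<close> (\<open>barrier_shift_second_moment\<close>).

  Finally \<open>Z\<close> is the sum of the shifts, each centred by its conditional mean given the past, divided by
  \<open>sqrt (n C\<^sub>p(2a))\<close>. The shifts are nonnegative, and a nonnegative variable has a Gaussian lower tail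
  controlled by its second moment alone, because \<open>exp (- u) \<le> 1 - u + u\<^sup>2 / 2\<close> for \<open>u \<ge> 0\<close>. Multiplying
  the conditional estimates and applying Markov's inequality gives the tail of \<open>Z\<close>
  (\<open>fluctuation_lower_tail\<close>).
\<close>

section \<open>Spectral decomposition of symmetric matrices\<close>

definition orthonormal_frame :: "('p \<Rightarrow> real^'p) \<Rightarrow> bool" where
  "orthonormal_frame e \<longleftrightarrow> (\<forall>i j. e i \<bullet> e j = (if i = j then 1 else 0))"

text \<open>The matrix acting as multiplication by \<open>f i\<close> on the direction \<open>e i\<close>. Keeping the frame fixed and
  varying \<open>f\<close> turns statements about inverses, traces and shifts of one symmetric matrix into
  statements about families of reals.\<close>

definition spectral_matrix :: "('p::finite \<Rightarrow> real^'p) \<Rightarrow> ('p \<Rightarrow> real) \<Rightarrow> real^'p^'p" where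
  "spectral_matrix e f = (\<Sum>i\<in>UNIV. f i *\<^sub>R outer_product (e i) (e i))"

lemma outer_product_mult_vec: "outer_product u v *v x = (v \<bullet> x) *\<^sub>R u"
  by (simp add: outer_product_def matrix_vector_mult_def vec_eq_iff inner_vec_def
      sum_distrib_left sum_distrib_right mult_ac)

lemma inner_outer_product_mult_vec: "v \<bullet> (outer_product x x *v v) = (x \<bullet> v)\<^sup>2"
  by (simp add: outer_product_mult_vec power2_eq_square inner_commute)

lemma trace_outer_product: "trace (outer_product u u) = (norm u)\<^sup>2"
  by (simp add: trace_def outer_product_def power2_norm_eq_inner inner_vec_def)

lemma trace_scaleR: "trace (c *\<^sub>R A) = c * trace (A :: real^'p^'p)"
  by (simp add: trace_def sum_distrib_left)

lemma trace_sum: "trace (\<Sum>i\<in>I. A i) = (\<Sum>i\<in>I. trace (A i :: real^'p^'p))"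
  by (induction I rule: infinite_finite_induct) (auto simp: trace_def sum.distrib)

lemma transpose_outer_product: "transpose (outer_product u u) = outer_product u u"
  by (simp add: outer_product_def transpose_def vec_eq_iff)

lemma transpose_add: "transpose (A + B) = transpose A + transpose (B :: real^'p^'q)"
  by (simp add: transpose_def vec_eq_iff)

lemma symmetric_inner:
  fixes A :: "real^'p^'p"
  assumes "transpose A = A"
  shows "(A *v u) \<bullet> v = u \<bullet> (A *v v)"
  by (metis assms dot_lmul_matrix transpose_matrix_vector)

lemma sum_mult_vec: "(\<Sum>i\<in>I. A i) *v x = (\<Sum>i\<in>I. A i *v (x :: real^'p))"
  by (induction I rule: infinite_finite_induct) (auto simp: matrix_vector_mult_add_rdistrib)

lemma spectral_matrix_mult_vec:
  "spectral_matrix e f *v x = (\<Sum>i\<in>UNIV. (f i * (e i \<bullet> x)) *\<^sub>R e i)"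
  by (simp add: spectral_matrix_def sum_mult_vec outer_product_mult_vec
      scaleR_matrix_vector_assoc[symmetric])

lemma transpose_spectral_matrix: "transpose (spectral_matrix e f) = spectral_matrix e f"
  by (simp add: spectral_matrix_def outer_product_def transpose_def vec_eq_iff mult_ac)

lemma inner_spectral_matrix:
  "x \<bullet> (spectral_matrix e f *v x) = (\<Sum>i\<in>UNIV. f i * (e i \<bullet> x)\<^sup>2)"
  by (simp add: spectral_matrix_mult_vec inner_sum_right power2_eq_square inner_commute mult_ac)

context
  fixes e :: "'p::finite \<Rightarrow> real^'p"
  assumes e: "orthonormal_frame e"
begin

lemma orthonormal_frame_sum: "e i \<bullet> (\<Sum>j\<in>UNIV. c j *\<^sub>R e j) = c i"
  using e by (simp add: inner_sum_right orthonormal_frame_def if_distrib[of "\<lambda>t. _ * t"] cong: if_cong)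

lemma orthonormal_frame_expansion: "(\<Sum>i\<in>UNIV. (e i \<bullet> x) *\<^sub>R e i) = x"
proof -
  define Q :: "real^'p^'p" where "Q = (\<chi> i. e i)"
  have "Q ** transpose Q = mat 1"
    using e by (simp add: Q_def matrix_mult_transpose_dot_row row_def orthonormal_frame_def
        mat_def vec_eq_iff)
  then have "transpose Q ** Q = mat 1"
    by (simp add: matrix_left_right_inverse)
  then have "x = transpose Q *v (Q *v x)"
    by (simp add: matrix_vector_mul_assoc del: transpose_matrix_vector)
  also have "\<dots> = (\<Sum>i\<in>UNIV. (e i \<bullet> x) *\<^sub>R e i)"
    by (simp add: Q_def matrix_vector_mult_def transpose_def vec_eq_iff inner_vec_def
        mult_ac del: transpose_matrix_vector)
  finally show ?thesis by simp
qed

lemma spectral_matrix_const: "spectral_matrix e (\<lambda>_. c) = c *\<^sub>R mat 1"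
  unfolding matrix_eq
  by (auto simp: spectral_matrix_mult_vec scaleR_scaleR[symmetric] scaleR_sum_right[symmetric]
      orthonormal_frame_expansion scaleR_matrix_vector_assoc[symmetric] simp del: scaleR_scaleR)

lemma spectral_matrix_mult:
  "spectral_matrix e f ** spectral_matrix e g = spectral_matrix e (\<lambda>i. f i * g i)"
  unfolding matrix_eq
  by (auto simp: matrix_vector_mul_assoc[symmetric] spectral_matrix_mult_vec
      orthonormal_frame_sum mult_ac)

lemma spectral_matrix_diff_const:
  "spectral_matrix e f - c *\<^sub>R mat 1 = spectral_matrix e (\<lambda>i. f i - c)"
  by (simp add: spectral_matrix_const[symmetric] spectral_matrix_def scaleR_diff_left sum_subtractf)

lemma trace_spectral_matrix: "trace (spectral_matrix e f) = (\<Sum>i\<in>UNIV. f i)"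
  using e by (simp add: spectral_matrix_def trace_sum trace_scaleR trace_outer_product
      power2_norm_eq_inner orthonormal_frame_def)

lemma norm_spectral_matrix_mult_vec:
  "(norm (spectral_matrix e f *v x))\<^sup>2 = (\<Sum>i\<in>UNIV. (f i)\<^sup>2 * (e i \<bullet> x)\<^sup>2)"
proof -
  have "(norm (spectral_matrix e f *v x))\<^sup>2 = x \<bullet> (spectral_matrix e f *v (spectral_matrix e f *v x))"
    by (simp add: power2_norm_eq_inner symmetric_inner transpose_spectral_matrix)
  then show ?thesis
    by (simp add: matrix_vector_mul_assoc spectral_matrix_mult inner_spectral_matrix power2_eq_square)
qed

lemma sum_norm_rows_spectral_matrix:
  "(\<Sum>i\<in>UNIV. (norm (row i (spectral_matrix e f)))\<^sup>2) = (\<Sum>i\<in>UNIV. (f i)\<^sup>2)"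
proof -
  have "(\<Sum>i\<in>UNIV. (norm (row i A))\<^sup>2) = trace (A ** transpose A)" for A :: "real^'p^'p"
    by (simp add: trace_def matrix_mult_transpose_dot_row power2_norm_eq_inner)
  then show ?thesis
    by (simp add: transpose_spectral_matrix spectral_matrix_mult trace_spectral_matrix power2_eq_square)
qed

end

lemma quadratic_nonneg_imp_linear_zero:
  fixes b c :: real
  assumes "\<And>t. 0 \<le> 2 * t * b + t\<^sup>2 * c"
  shows "b = 0"
proof (rule ccontr)
  assume b: "b \<noteq> 0"
  \<comment> \<open>A positive upper bound for \<open>c\<close>, so that the parabola with leading coefficient \<open>k\<close> has the
    minimiser \<open>- b / k\<close>, where it is negative.\<close>
  define k where "k = \<bar>c\<bar> + 1"
  have k: "k > 0" "c \<le> k" unfolding k_def by auto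
  have "0 \<le> 2 * (- b / k) * b + (- b / k)\<^sup>2 * c" by (rule assms)
  also have "\<dots> \<le> 2 * (- b / k) * b + (- b / k)\<^sup>2 * k"
    using k by (intro add_left_mono mult_left_mono) auto
  also have "\<dots> = - b\<^sup>2 / k"
    using k by (simp add: power2_eq_square field_simps)
  also have "\<dots> < 0" using b k by simp
  finally show False by simp
qed

text \<open>A minimiser of the quadratic form over the unit vectors orthogonal to \<open>E\<close> is an eigenvector: the
  first variation vanishes in the directions orthogonal to \<open>E\<close>, and in the directions of \<open>E\<close> it
  vanishes because \<open>A\<close> maps each element of \<open>E\<close> to a multiple of itself.\<close>
lemma exists_eigenvector_orthogonal_to_eigenvectors:
  fixes A :: "real^'p^'p"
  assumes sym: "transpose A = A"
    and E: "finite E" "card E < CARD('p)" "\<And>u. u \<in> E \<Longrightarrow> \<exists>l. A *v u = l *\<^sub>R u"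
  shows "\<exists>v l. norm v = 1 \<and> (\<forall>u\<in>E. u \<bullet> v = 0) \<and> A *v v = l *\<^sub>R v"
proof -
  define S where "S = {v :: real^'p. norm v = 1 \<and> (\<forall>u\<in>E. u \<bullet> v = 0)}"
  have "dim E < DIM(real^'p)"
    using dim_le_card'[OF E(1)] E(2) by simp
  then obtain x where x: "x \<noteq> 0" "\<And>y. y \<in> span E \<Longrightarrow> orthogonal x y"
    using orthogonal_to_subspace_exists[of E] by blast
  have "x /\<^sub>R norm x \<in> S"
    using x by (auto simp: S_def orthogonal_def span_base inner_commute)
  then have ne: "S \<noteq> {}" by auto
  have "S = sphere 0 1 \<inter> (\<Inter>u\<in>E. {v. u \<bullet> v = 0})"
    by (auto simp: S_def)
  moreover have "closed (\<Inter>u\<in>E. {v. u \<bullet> v = 0})"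
    by (intro closed_INT ballI closed_hyperplane)
  ultimately have "compact S"
    by (simp add: compact_Int_closed)
  moreover have "continuous_on S (\<lambda>v. v \<bullet> (A *v v))"
    by (intro continuous_intros linear_continuous_on) (simp add: linear_conv_bounded_linear[symmetric])
  ultimately obtain v where v: "v \<in> S" "\<And>w. w \<in> S \<Longrightarrow> v \<bullet> (A *v v) \<le> w \<bullet> (A *v w)"
    using continuous_attains_inf[OF _ ne] by blast
  define m where "m = v \<bullet> (A *v v)"
  have vn: "v \<bullet> v = 1" and vE: "\<And>u. u \<in> E \<Longrightarrow> u \<bullet> v = 0"
    using v(1) by (auto simp: S_def norm_eq_1)
  have m: "m * (w \<bullet> w) \<le> w \<bullet> (A *v w)" if w: "\<And>u. u \<in> E \<Longrightarrow> u \<bullet> w = 0" for w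
  proof (cases "w = 0")
    case False
    then have "w /\<^sub>R norm w \<in> S" using w by (auto simp: S_def)
    from v(2)[OF this] show ?thesis
      using False
      by (simp add: m_def[symmetric] matrix_vector_mult_scaleR power2_norm_eq_inner[symmetric]
          power2_eq_square field_simps)
  qed simp
  have orth: "w \<bullet> (A *v v - m *\<^sub>R v) = 0" if w: "\<And>u. u \<in> E \<Longrightarrow> u \<bullet> w = 0" for w
  proof (rule quadratic_nonneg_imp_linear_zero)
    fix t :: real
    have "m * ((v + t *\<^sub>R w) \<bullet> (v + t *\<^sub>R w)) \<le> (v + t *\<^sub>R w) \<bullet> (A *v (v + t *\<^sub>R w))"
      using w vE by (intro m) (simp add: inner_add_right)
    moreover have "v \<bullet> (A *v w) = w \<bullet> (A *v v)"
      by (metis sym symmetric_inner inner_commute)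
    ultimately show "0 \<le> 2 * t * (w \<bullet> (A *v v - m *\<^sub>R v)) + t\<^sup>2 * (w \<bullet> (A *v w) - m * (w \<bullet> w))"
      using vn
      by (simp add: algebra_simps matrix_vector_mult_scaleR matrix_vector_right_distrib
          power2_eq_square inner_commute m_def)
  qed
  have "u \<bullet> (A *v v - m *\<^sub>R v) = 0" if u: "u \<in> E" for u
  proof -
    obtain l where "A *v u = l *\<^sub>R u" using E(3) u by auto
    then show ?thesis
      using vE[OF u] by (simp add: inner_diff_right symmetric_inner[OF sym, symmetric])
  qed
  from orth[OF this] have "A *v v = m *\<^sub>R v" by simp
  then show ?thesis using v(1) by (auto simp: S_def)
qed

lemma symmetric_matrix_spectral:
  fixes A :: "real^'p^'p"
  assumes sym: "transpose A = A"
  obtains e l where "orthonormal_frame e" "A = spectral_matrix e l"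
proof -
  have "k \<le> CARD('p) \<Longrightarrow> \<exists>E. finite E \<and> card E = k \<and>
      (\<forall>u\<in>E. norm u = 1 \<and> (\<exists>l. A *v u = l *\<^sub>R u)) \<and> (\<forall>u\<in>E. \<forall>w\<in>E. u \<noteq> w \<longrightarrow> u \<bullet> w = 0)" for k
  proof (induction k)
    case 0
    then show ?case by (intro exI[of _ "{}"]) simp
  next
    case (Suc k)
    then obtain E where E: "finite E" "card E = k"
      "\<And>u. u \<in> E \<Longrightarrow> norm u = 1 \<and> (\<exists>l. A *v u = l *\<^sub>R u)"
      "\<And>u w. u \<in> E \<Longrightarrow> w \<in> E \<Longrightarrow> u \<noteq> w \<Longrightarrow> u \<bullet> w = 0"
      by auto
    obtain v l where v: "norm v = 1" "\<And>u. u \<in> E \<Longrightarrow> u \<bullet> v = 0" "A *v v = l *\<^sub>R v"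
      using exists_eigenvector_orthogonal_to_eigenvectors[OF sym E(1)] E(2,3) Suc.prems by auto
    have "v \<notin> E"
      using v by (metis norm_eq_1 zero_neq_one)
    then show ?case
      using E v by (intro exI[of _ "insert v E"]) (auto simp: inner_commute)
  qed
  from this[of "CARD('p)"] obtain E where E: "finite E" "card E = CARD('p)"
      "\<And>u. u \<in> E \<Longrightarrow> norm u = 1 \<and> (\<exists>l. A *v u = l *\<^sub>R u)"
      "\<And>u w. u \<in> E \<Longrightarrow> w \<in> E \<Longrightarrow> u \<noteq> w \<Longrightarrow> u \<bullet> w = 0"
    by auto
  obtain e where e: "bij_betw e (UNIV :: 'p set) E"
    using E(1,2) finite_same_card_bij[of "UNIV :: 'p set" E] by auto
  have eE: "e i \<in> E" for i using e by (auto simp: bij_betw_def)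
  have inj: "e i = e j \<longleftrightarrow> i = j" for i j using e by (auto simp: bij_betw_def inj_on_def)
  obtain l where l: "\<And>i. A *v e i = l i *\<^sub>R e i"
    using E(3)[OF eE] by metis
  have fr: "orthonormal_frame e"
    unfolding orthonormal_frame_def using E(3,4)[OF eE] eE inj by (auto simp: norm_eq_1)
  have "A = spectral_matrix e l"
    unfolding matrix_eq
  proof
    fix x
    have "A *v x = A *v (\<Sum>i\<in>UNIV. (e i \<bullet> x) *\<^sub>R e i)"
      by (simp add: orthonormal_frame_expansion[OF fr])
    also have "\<dots> = (\<Sum>i\<in>UNIV. (e i \<bullet> x) *\<^sub>R (A *v e i))"
      by (simp add: linear_sum[OF matrix_vector_mul_linear] matrix_vector_mult_scaleR)
    also have "\<dots> = spectral_matrix e l *v x"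
      by (simp add: spectral_matrix_mult_vec l mult_ac)
    finally show "A *v x = spectral_matrix e l *v x" .
  qed
  then show ?thesis using that fr by blast
qed

text \<open>In an eigenframe the eigenvalues are exactly the finitely many diagonal entries, so the least one
  exists and has an eigenvector, on which the quadratic form can be evaluated.\<close>
lemma smallest_eigenvalue_ge:
  fixes A :: "real^'p^'p"
  assumes sym: "transpose A = A" and ge: "\<And>v. c * (v \<bullet> v) \<le> v \<bullet> (A *v v)"
  shows "c \<le> smallest_eigenvalue A"
proof -
  obtain e l where e: "orthonormal_frame e" and A: "A = spectral_matrix e l"
    using symmetric_matrix_spectral[OF sym] .
  have eig: "is_eigenvalue A k \<longleftrightarrow> k \<in> range l" for k
  proof
    assume "is_eigenvalue A k"
    then obtain v where v: "v \<noteq> 0" "A *v v = k *\<^sub>R v" by (auto simp: is_eigenvalue_def)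
    have "\<exists>i. e i \<bullet> v \<noteq> 0"
    proof (rule ccontr)
      assume "\<not> ?thesis"
      then have "(\<Sum>i\<in>UNIV. (e i \<bullet> v) *\<^sub>R e i) = 0" by simp
      then show False using v(1) by (simp add: orthonormal_frame_expansion[OF e])
    qed
    then obtain i where i: "e i \<bullet> v \<noteq> 0" ..
    have "k * (e i \<bullet> v) = e i \<bullet> (A *v v)" using v by simp
    also have "\<dots> = l i * (e i \<bullet> v)"
      by (simp add: A spectral_matrix_mult_vec orthonormal_frame_sum[OF e])
    finally show "k \<in> range l" using i by simp
  next
    assume "k \<in> range l"
    then obtain i where k: "k = l i" by auto
    have "A *v e i = (\<Sum>j\<in>UNIV. (if j = i then l i else 0) *\<^sub>R e j)"
      unfolding A spectral_matrix_mult_vec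
      using e by (intro sum.cong) (auto simp: orthonormal_frame_def)
    also have "\<dots> = l i *\<^sub>R e i"
      by (simp add: if_distrib[of "\<lambda>c. c *\<^sub>R _"] cong: if_cong)
    finally have "A *v e i = l i *\<^sub>R e i" .
    moreover have "e i \<bullet> e i = 1" using e by (simp add: orthonormal_frame_def)
    then have "e i \<noteq> 0" by auto
    ultimately show "is_eigenvalue A k" unfolding is_eigenvalue_def k by blast
  qed
  have "smallest_eigenvalue A = Min (range l)"
    unfolding smallest_eigenvalue_def by (intro Least_equality) (simp_all add: eig)
  moreover have "Min (range l) \<in> range l" by (intro Min_in) auto
  ultimately have "is_eigenvalue A (smallest_eigenvalue A)" by (simp add: eig)
  then obtain v where "v \<noteq> 0" "A *v v = smallest_eigenvalue A *\<^sub>R v"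
    by (auto simp: is_eigenvalue_def)
  then show ?thesis using ge[of v] by simp
qed

section \<open>Inverse matrices\<close>

text \<open>Cramer's rule is used as the definition, since a quotient of polynomials in the
  entries is visibly Borel measurable in the matrix. A singular matrix has determinant \<open>0\<close> and is sent
  to \<open>0\<close>; along the process only positive definite matrices are inverted.\<close>

definition cramer_inverse :: "real^'p^'p \<Rightarrow> real^'p^'p" where
  "cramer_inverse A =
     (\<chi> k j. det (\<chi> i m. if m = k then axis j 1 $ i else A $ i $ m) / det A)"

lemma cramer_inverse_eqI:
  fixes A H :: "real^'p^'p"
  assumes AH: "A ** H = mat 1"
  shows "cramer_inverse A = H"
proof -
  have "det A \<noteq> 0"
    using AH invertible_det_nz[of A] invertible_right_inverse[of A] by blast
  moreover have "A *v column j H = axis j 1" for j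
    using AH by (metis matrix_vector_mul_assoc matrix_vector_mult_basis matrix_vector_mul_lid)
  ultimately have "column j H = (\<chi> k. det (\<chi> i m. if m = k then axis j 1 $ i else A $ i $ m) / det A)" for j
    by (simp add: cramer)
  then show ?thesis
    by (simp add: cramer_inverse_def vec_eq_iff column_def)
qed

lemma sherman_morrison:
  fixes C H :: "real^'p^'p"
  assumes CH: "C ** H = mat 1" and H: "transpose H = H" and pos: "0 \<le> x \<bullet> (H *v x)"
  shows "(C + outer_product x x) **
      (H - (1 / (1 + x \<bullet> (H *v x))) *\<^sub>R outer_product (H *v x) (H *v x)) = mat 1"
  unfolding matrix_eq
proof
  fix v
  define q where "q = x \<bullet> (H *v x)"
  define w where "w = x \<bullet> (H *v v)"
  have CHv: "C *v (H *v u) = u" for u by (simp add: matrix_vector_mul_assoc CH)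
  have Hw: "(H *v x) \<bullet> v = w" by (simp add: w_def symmetric_inner[OF H])
  have "((C + outer_product x x) ** (H - (1 / (1 + q)) *\<^sub>R outer_product (H *v x) (H *v x))) *v v
    = (C + outer_product x x) *v (H *v v - (w / (1 + q)) *\<^sub>R (H *v x))"
    by (simp add: matrix_vector_mul_assoc[symmetric] matrix_vector_mult_diff_rdistrib
        scaleR_matrix_vector_assoc[symmetric] outer_product_mult_vec Hw)
  also have "\<dots> = v - (w / (1 + q)) *\<^sub>R x + w *\<^sub>R x - (w / (1 + q) * q) *\<^sub>R x"
    by (simp add: matrix_vector_mult_add_rdistrib matrix_vector_mult_diff_distrib
        matrix_vector_mult_scaleR outer_product_mult_vec CHv q_def[symmetric] w_def[symmetric]
        inner_diff_right algebra_simps)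
  also have "\<dots> = v + (w - w / (1 + q) - w / (1 + q) * q) *\<^sub>R x"
    by (simp add: algebra_simps)
  also have "w - w / (1 + q) - w / (1 + q) * q = 0"
    using pos by (simp add: q_def[symmetric] field_simps)
  finally show "((C + outer_product x x) ** (H - (1 / (1 + x \<bullet> (H *v x))) *\<^sub>R outer_product (H *v x) (H *v x))) *v v = mat 1 *v v"
    by (simp add: q_def)
qed

section \<open>The barrier and its shift\<close>

definition barrier :: "real \<Rightarrow> real^'p^'p \<Rightarrow> bool" where
  "barrier \<phi> B \<longleftrightarrow> transpose B = B \<and> (\<forall>v. v \<noteq> 0 \<longrightarrow> 0 < v \<bullet> (B *v v)) \<and>
     trace (cramer_inverse B) \<le> \<phi>"

text \<open>The ratio \<open>|G x|\<^sup>2 / tr (G G\<^sup>T)\<close>. Written with the rows of \<open>G\<close> it is a convex combination of the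
  squares \<open>(x, v)\<^sup>2\<close> over the normalised rows \<open>v\<close>, for every nonzero \<open>G\<close>; if \<open>G = 0\<close> it is \<open>0\<close>.\<close>

definition row_energy :: "real^'p^'p \<Rightarrow> real^'p \<Rightarrow> real" where
  "row_energy G x = (norm (G *v x))\<^sup>2 / (\<Sum>i\<in>UNIV. (norm (row i G))\<^sup>2)"

text \<open>The truncation \<open>t\<close> of the energy bounds the shift by \<open>a\<close>. The absolute value, which is the form
  itself when \<open>B\<close> is positive definite, keeps the shift between \<open>0\<close> and \<open>t\<close> for every matrix \<open>B\<close>, so
  that the second moment is controlled uniformly over all states.\<close>

definition barrier_shift :: "real \<Rightarrow> real \<Rightarrow> real^'p^'p \<Rightarrow> real^'p \<Rightarrow> real" where
  "barrier_shift \<phi> a B x =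
     (let G = cramer_inverse B; t = min (row_energy G x) a
      in max 0 (t * (1 - \<phi> * t - \<bar>x \<bullet> (G *v x)\<bar>)))"

definition barrier_update :: "real \<Rightarrow> real \<Rightarrow> real^'p^'p \<Rightarrow> real^'p \<Rightarrow> real^'p^'p" where
  "barrier_update \<phi> a B x = B - barrier_shift \<phi> a B x *\<^sub>R mat 1 + outer_product x x"

lemma row_energy_nonneg: "0 \<le> row_energy G x"
  by (simp add: row_energy_def sum_nonneg)

lemma barrier_shift_nonneg: "0 \<le> barrier_shift \<phi> a B x"
  by (simp add: barrier_shift_def Let_def)

lemma barrier_shift_le:
  assumes "0 \<le> \<phi>" "0 \<le> a"
  shows "barrier_shift \<phi> a B x \<le> min (row_energy (cramer_inverse B) x) a"
proof -
  define t where "t = min (row_energy (cramer_inverse B) x) a"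
  have t: "0 \<le> t" using assms row_energy_nonneg[of "cramer_inverse B" x] by (simp add: t_def)
  have "t * (1 - \<phi> * t - \<bar>x \<bullet> (cramer_inverse B *v x)\<bar>) \<le> t * 1"
    using mult_nonneg_nonneg[OF assms(1) t] t by (intro mult_left_mono) auto
  then show ?thesis using t by (simp add: barrier_shift_def Let_def t_def)
qed

text \<open>The starting point of the process.\<close>
lemma barrier_scaled_identity:
  assumes "0 < c"
  shows "barrier (real CARD('p) / c) (c *\<^sub>R mat 1 :: real^'p^'p)"
proof -
  have "(c *\<^sub>R mat 1 :: real^'p^'p) ** ((1 / c) *\<^sub>R mat 1) = mat 1"
    using assms
    by (simp add: matrix_eq matrix_vector_mul_assoc[symmetric] scaleR_matrix_vector_assoc[symmetric])
  then have "cramer_inverse (c *\<^sub>R mat 1 :: real^'p^'p) = (1 / c) *\<^sub>R mat 1"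
    by (rule cramer_inverse_eqI)
  moreover have "transpose (c *\<^sub>R mat 1 :: real^'p^'p) = c *\<^sub>R mat 1"
    by (simp add: transpose_scalar)
  ultimately show ?thesis
    using assms unfolding barrier_def
    by (simp add: trace_scaleR trace_I scaleR_matrix_vector_assoc[symmetric])
qed

lemma barrier_spectral:
  fixes B :: "real^'p^'p"
  assumes "barrier \<phi> B"
  obtains e l where "orthonormal_frame e" "B = spectral_matrix e l" "\<And>i. 0 < l i"
    "cramer_inverse B = spectral_matrix e (\<lambda>i. 1 / l i)" "(\<Sum>i\<in>UNIV. 1 / l i) \<le> \<phi>"
proof -
  obtain e l where e: "orthonormal_frame e" and B: "B = spectral_matrix e l"
    using symmetric_matrix_spectral assms unfolding barrier_def by blast
  have l: "0 < l i" for i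
  proof -
    have "e i \<bullet> e i = 1" using e by (simp add: orthonormal_frame_def)
    then have "e i \<noteq> 0" by auto
    then have "0 < e i \<bullet> (B *v e i)" using assms by (simp add: barrier_def)
    also have "\<dots> = (\<Sum>j\<in>UNIV. if j = i then l i else 0)"
      unfolding B inner_spectral_matrix
      using e by (intro sum.cong) (auto simp: orthonormal_frame_def)
    finally show ?thesis by simp
  qed
  have "B ** spectral_matrix e (\<lambda>i. 1 / l i) = mat 1"
    using l by (simp add: B spectral_matrix_mult[OF e] less_imp_neq[symmetric]
        spectral_matrix_const[OF e])
  then have G: "cramer_inverse B = spectral_matrix e (\<lambda>i. 1 / l i)" by (rule cramer_inverse_eqI)
  moreover have "(\<Sum>i\<in>UNIV. 1 / l i) \<le> \<phi>"
    using assms by (simp add: barrier_def G trace_spectral_matrix[OF e])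
  ultimately show ?thesis using that e B l by blast
qed

text \<open>The trace comparison in an eigenframe. The \<open>\<mu> i\<close> are the eigenvalues of the inverse before the
  step, the \<open>\<alpha> i\<close> those after the barrier has moved by \<open>d\<close>, and \<open>s i\<close> are the squared coordinates of
  the new vector. The left-hand side of the first conclusion is the trace of the new inverse according to
  Sherman and Morrison. Since \<open>d \<mu> i \<le> d \<phi>\<close>, one has \<open>\<mu> i \<le> \<alpha> i \<le> \<mu> i / (1 - d \<phi>)\<close>, which replaces every
  \<open>\<alpha>\<close> by \<open>\<mu>\<close> in the unfavourable direction and leaves the assumption \<open>shift\<close>.\<close>
lemma resolvent_trace_step:
  fixes \<mu> s :: "'i::finite \<Rightarrow> real"
  assumes \<mu>: "\<And>i. 0 < \<mu> i" "(\<Sum>i\<in>UNIV. \<mu> i) \<le> \<phi>" and s: "\<And>i. 0 \<le> s i"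
    and d: "0 \<le> d" "d * \<phi> < 1"
    and shift: "d * (1 - d * \<phi> + (\<Sum>i\<in>UNIV. \<mu> i * s i)) * (\<Sum>i\<in>UNIV. (\<mu> i)\<^sup>2)
       \<le> (1 - d * \<phi>)\<^sup>2 * (\<Sum>i\<in>UNIV. (\<mu> i)\<^sup>2 * s i)"
  defines "\<alpha> \<equiv> \<lambda>i. 1 / (1 / \<mu> i - d)"
  shows "(\<Sum>i\<in>UNIV. \<alpha> i) - (\<Sum>i\<in>UNIV. (\<alpha> i)\<^sup>2 * s i) / (1 + (\<Sum>i\<in>UNIV. \<alpha> i * s i)) \<le> (\<Sum>i\<in>UNIV. \<mu> i)"
    and "0 < 1 / \<mu> i - d"
proof -
  define r where "r = 1 - d * \<phi>"
  define Q where "Q = (\<Sum>i\<in>UNIV. \<mu> i * s i)"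
  define R where "R = (\<Sum>i\<in>UNIV. (\<mu> i)\<^sup>2 * s i)"
  define U where "U = (\<Sum>i\<in>UNIV. (\<mu> i)\<^sup>2)"
  have r: "0 < r" using d by (simp add: r_def)
  have Q: "0 \<le> Q" and R: "0 \<le> R"
    using less_imp_le[OF \<mu>(1)] s by (auto simp: Q_def R_def intro!: sum_nonneg mult_nonneg_nonneg)
  have \<mu>r: "r \<le> 1 - d * \<mu> i" for i
  proof -
    have "\<mu> i \<le> (\<Sum>i\<in>UNIV. \<mu> i)" using \<mu>(1) by (intro member_le_sum) (auto intro: less_imp_le)
    then have "d * \<mu> i \<le> d * \<phi>" using \<mu>(2) d by (intro mult_left_mono) auto
    then show ?thesis by (simp add: r_def)
  qed
  have pos: "0 < 1 - d * \<mu> i" for i using \<mu>r[of i] r by simp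
  have \<alpha>: "\<alpha> i = \<mu> i / (1 - d * \<mu> i)" for i
    using \<mu>(1)[of i] pos[of i] by (simp add: \<alpha>_def field_simps)
  show "0 < 1 / \<mu> i - d" using pos[of i] \<mu>(1)[of i] by (simp add: field_simps)
  have \<alpha>_ge: "\<mu> i \<le> \<alpha> i" for i
  proof -
    have "\<mu> i * (1 - d * \<mu> i) \<le> \<mu> i * 1"
      using \<mu>(1)[of i] d by (intro mult_left_mono) auto
    then show ?thesis using pos[of i] by (simp add: \<alpha> pos_le_divide_eq)
  qed
  have \<alpha>_le: "\<alpha> i \<le> \<mu> i / r" for i
    unfolding \<alpha> using \<mu>r[of i] r \<mu>(1)[of i] by (intro divide_left_mono) auto
  have growth: "(\<Sum>i\<in>UNIV. \<alpha> i) - (\<Sum>i\<in>UNIV. \<mu> i) \<le> d * U / r"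
  proof -
    have "\<alpha> i - \<mu> i = d * \<mu> i * \<alpha> i" for i
      using pos[of i] by (simp add: \<alpha> field_simps)
    then have "(\<Sum>i\<in>UNIV. \<alpha> i) - (\<Sum>i\<in>UNIV. \<mu> i) = (\<Sum>i\<in>UNIV. d * \<mu> i * \<alpha> i)"
      by (simp add: sum_subtractf[symmetric])
    also have "\<dots> \<le> (\<Sum>i\<in>UNIV. d * \<mu> i * (\<mu> i / r))"
      using less_imp_le[OF \<mu>(1)] d
      by (intro sum_mono mult_left_mono \<alpha>_le) (auto intro!: mult_nonneg_nonneg)
    also have "\<dots> = d * U / r"
      by (simp add: U_def sum_divide_distrib sum_distrib_left power2_eq_square mult_ac)
    finally show ?thesis .
  qed
  have num: "R \<le> (\<Sum>i\<in>UNIV. (\<alpha> i)\<^sup>2 * s i)"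
    unfolding R_def using \<mu>(1) s \<alpha>_ge
    by (intro sum_mono mult_right_mono power_mono) (auto intro: less_imp_le)
  have "(\<Sum>i\<in>UNIV. \<alpha> i * s i) \<le> (\<Sum>i\<in>UNIV. \<mu> i / r * s i)"
    using s by (intro sum_mono mult_right_mono \<alpha>_le)
  then have den: "1 + (\<Sum>i\<in>UNIV. \<alpha> i * s i) \<le> 1 + Q / r"
    by (simp add: Q_def sum_divide_distrib)
  have "0 \<le> (\<Sum>i\<in>UNIV. \<alpha> i * s i)"
    using s order_trans[OF less_imp_le[OF \<mu>(1)] \<alpha>_ge] by (intro sum_nonneg mult_nonneg_nonneg) auto
  then have "R / (1 + Q / r) \<le> (\<Sum>i\<in>UNIV. (\<alpha> i)\<^sup>2 * s i) / (1 + (\<Sum>i\<in>UNIV. \<alpha> i * s i))"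
    using num den R by (intro frac_le) auto
  moreover have "d * U / r \<le> R / (1 + Q / r)"
  proof -
    have "d * U * (r + Q) \<le> r\<^sup>2 * R"
      using shift by (simp add: r_def Q_def R_def U_def mult_ac)
    moreover have "1 + Q / r = (r + Q) / r"
      using r by (simp add: field_simps)
    then have "R / (1 + Q / r) = r\<^sup>2 * R / (r + Q) / r"
      using r by (simp add: power2_eq_square)
    ultimately show ?thesis
      using r Q by (simp add: divide_right_mono pos_le_divide_eq)
  qed
  ultimately show "(\<Sum>i\<in>UNIV. \<alpha> i) - (\<Sum>i\<in>UNIV. (\<alpha> i)\<^sup>2 * s i) / (1 + (\<Sum>i\<in>UNIV. \<alpha> i * s i)) \<le> (\<Sum>i\<in>UNIV. \<mu> i)"
    using growth by linarith
qed

text \<open>The chosen shift satisfies the requirement of the trace comparison: with \<open>r = 1 - d \<phi>\<close> one has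
  \<open>d \<le> t (r - q)\<close>, because \<open>d \<le> t\<close>, and \<open>(r - q) (r + q) \<le> r\<^sup>2\<close>.\<close>
lemma barrier_shift_feasible:
  fixes \<phi> t q R :: real
  assumes \<phi>: "0 \<le> \<phi>" and t: "0 \<le> t" "t \<le> R" and "\<phi> * t \<le> 1" and q: "0 \<le> q"
    and d: "d = max 0 (t * (1 - \<phi> * t - q))"
  shows "d * (1 - d * \<phi> + q) \<le> (1 - d * \<phi>)\<^sup>2 * R"
proof (cases "d = 0")
  case True
  then show ?thesis using t by simp
next
  case False
  define r where "r = 1 - d * \<phi>"
  have dt: "d = t * (1 - \<phi> * t - q)" and dpos: "0 < d" using False d by auto
  have "d \<le> t * 1"
    unfolding dt using mult_nonneg_nonneg[OF \<phi> t(1)] q t by (intro mult_left_mono) auto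
  then have "\<phi> * d \<le> \<phi> * t" using \<phi> by (intro mult_left_mono) auto
  then have r: "1 - \<phi> * t \<le> r" "0 \<le> r" using assms(4) by (auto simp: r_def mult.commute)
  have "d * (r + q) \<le> (t * (r - q)) * (r + q)"
    unfolding dt using r t q by (intro mult_right_mono mult_left_mono) auto
  also have "\<dots> = t * r\<^sup>2 - t * q\<^sup>2" by (simp add: power2_eq_square algebra_simps)
  also have "\<dots> \<le> t * r\<^sup>2" using t by simp
  also have "\<dots> \<le> R * r\<^sup>2" using t by (intro mult_right_mono) auto
  finally show ?thesis by (simp add: r_def mult.commute)
qed

text \<open>The eigenvalues of \<open>B\<close> are at least \<open>1 / \<phi> > a\<close>, hence stay positive after the barrier has moved by at
  most \<open>a\<close>; adding \<open>x x\<^sup>T\<close> preserves positivity and brings the trace of the inverse back to at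
  most its old value.\<close>
lemma barrier_preserved:
  fixes B :: "real^'p^'p"
  assumes B: "barrier \<phi> B" and a: "0 < a" "\<phi> * a < 1"
  shows "barrier \<phi> (barrier_update \<phi> a B x)"
proof -
  obtain e l where e: "orthonormal_frame e" and Bl: "B = spectral_matrix e l"
    and l: "\<And>i. 0 < l i" and G: "cramer_inverse B = spectral_matrix e (\<lambda>i. 1 / l i)"
    and tr: "(\<Sum>i\<in>UNIV. 1 / l i) \<le> \<phi>"
    using barrier_spectral[OF B] by blast
  define \<mu> where "\<mu> i = 1 / l i" for i
  define s where "s i = (e i \<bullet> x)\<^sup>2" for i
  define d where "d = barrier_shift \<phi> a B x"
  define R where "R = row_energy (cramer_inverse B) x"
  define q where "q = (\<Sum>i\<in>UNIV. \<mu> i * s i)"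
  define t where "t = min R a"
  have \<mu>: "0 < \<mu> i" for i using l by (simp add: \<mu>_def)
  have s: "0 \<le> s i" for i by (simp add: s_def)
  have U: "0 < (\<Sum>i\<in>UNIV. (\<mu> i)\<^sup>2)"
    using less_imp_neq[OF \<mu>] by (intro sum_pos) auto
  have "0 < (\<Sum>i\<in>UNIV. \<mu> i)" using \<mu> by (intro sum_pos) auto
  then have \<phi>: "0 < \<phi>" using tr by (simp add: \<mu>_def)
  have R: "R * (\<Sum>i\<in>UNIV. (\<mu> i)\<^sup>2) = (\<Sum>i\<in>UNIV. (\<mu> i)\<^sup>2 * s i)"
    using U by (simp add: R_def row_energy_def G sum_norm_rows_spectral_matrix[OF e]
        norm_spectral_matrix_mult_vec[OF e] \<mu>_def[symmetric] s_def[symmetric])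
  have q: "x \<bullet> (cramer_inverse B *v x) = q" "0 \<le> q"
    using less_imp_le[OF l] by (auto simp: G inner_spectral_matrix q_def \<mu>_def s_def
        intro!: sum_nonneg mult_nonneg_nonneg)
  have t: "0 \<le> t" "t \<le> R" "t \<le> a"
    using a row_energy_nonneg[of "cramer_inverse B" x] by (auto simp: t_def R_def)
  have d: "d = max 0 (t * (1 - \<phi> * t - q))"
    using q by (simp add: d_def barrier_shift_def Let_def t_def R_def)
  have d0: "0 \<le> d" by (simp add: d)
  have "d \<le> a" using barrier_shift_le[of \<phi> a B x] \<phi> a by (simp add: d_def)
  then have "d * \<phi> \<le> a * \<phi>" using \<phi> by (intro mult_right_mono) auto
  then have d1: "d * \<phi> < 1" using a by (simp add: mult.commute)
  have "\<phi> * t \<le> \<phi> * a" using t \<phi> by (intro mult_left_mono) auto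
  then have "\<phi> * t \<le> 1" using a by simp
  then have "d * (1 - d * \<phi> + q) \<le> (1 - d * \<phi>)\<^sup>2 * R"
    using t q a \<phi> by (intro barrier_shift_feasible[OF _ _ _ _ _ d]) auto
  then have "d * (1 - d * \<phi> + q) * (\<Sum>i\<in>UNIV. (\<mu> i)\<^sup>2) \<le> (1 - d * \<phi>)\<^sup>2 * R * (\<Sum>i\<in>UNIV. (\<mu> i)\<^sup>2)"
    using U by (intro mult_right_mono) auto
  then have "d * (1 - d * \<phi> + (\<Sum>i\<in>UNIV. \<mu> i * s i)) * (\<Sum>i\<in>UNIV. (\<mu> i)\<^sup>2)
      \<le> (1 - d * \<phi>)\<^sup>2 * (\<Sum>i\<in>UNIV. (\<mu> i)\<^sup>2 * s i)"
    by (simp add: R[symmetric] q_def mult.assoc)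
  note step = resolvent_trace_step[OF \<mu> tr[folded \<mu>_def] s d0 d1 this]
  define \<alpha> where "\<alpha> i = 1 / (1 / \<mu> i - d)" for i
  have ld: "0 < l i - d" for i using step(2)[of i] by (simp add: \<mu>_def)
  have \<alpha>l: "\<alpha> i = 1 / (l i - d)" for i by (simp add: \<alpha>_def \<mu>_def)
  define C where "C = spectral_matrix e (\<lambda>i. l i - d)"
  define H where "H = spectral_matrix e \<alpha>"
  have upd: "barrier_update \<phi> a B x = C + outer_product x x"
    unfolding C_def spectral_matrix_diff_const[OF e, symmetric]
    by (simp add: barrier_update_def d_def Bl)
  have ld0: "l i - d \<noteq> 0" for i using ld[of i] by simp
  have CH: "C ** H = mat 1"
    unfolding C_def H_def spectral_matrix_mult[OF e] \<alpha>l
    using ld0 spectral_matrix_const[OF e, of 1] by simp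
  have H: "transpose H = H" by (simp add: H_def transpose_spectral_matrix)
  have xHx: "x \<bullet> (H *v x) = (\<Sum>i\<in>UNIV. \<alpha> i * s i)"
    by (simp add: H_def inner_spectral_matrix s_def)
  have "0 \<le> x \<bullet> (H *v x)"
    unfolding xHx using s ld by (intro sum_nonneg mult_nonneg_nonneg) (auto simp: \<alpha>l intro: less_imp_le)
  from cramer_inverse_eqI[OF sherman_morrison[OF CH H this]]
  have inv: "cramer_inverse (C + outer_product x x) =
      H - (1 / (1 + x \<bullet> (H *v x))) *\<^sub>R outer_product (H *v x) (H *v x)" .
  have "trace (cramer_inverse (C + outer_product x x)) \<le> (\<Sum>i\<in>UNIV. \<mu> i)"
    using step(1) unfolding inv
    unfolding trace_sub trace_scaleR trace_outer_product xHx
    unfolding H_def trace_spectral_matrix[OF e] norm_spectral_matrix_mult_vec[OF e]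
    by (simp add: \<alpha>_def s_def)
  moreover have "0 < v \<bullet> ((C + outer_product x x) *v v)" if v: "v \<noteq> 0" for v
  proof -
    have "(\<Sum>i\<in>UNIV. (e i \<bullet> v)\<^sup>2) = (norm v)\<^sup>2"
      using inner_spectral_matrix[of v e "\<lambda>_. 1"] spectral_matrix_const[OF e, of 1]
      by (simp add: power2_norm_eq_inner)
    then have "\<exists>i. e i \<bullet> v \<noteq> 0" using v by (metis (no_types, lifting) norm_eq_zero power_zero_numeral sum.neutral zero_eq_power2)
    then obtain i where i: "e i \<bullet> v \<noteq> 0" ..
    have "0 < v \<bullet> (C *v v)"
      unfolding C_def inner_spectral_matrix using ld i
      by (intro sum_pos2[of _ i]) (auto intro!: mult_nonneg_nonneg less_imp_le[OF ld, simplified])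
    then show ?thesis
      by (simp add: matrix_vector_mult_add_rdistrib inner_add_right add_pos_nonneg inner_outer_product_mult_vec)
  qed
  moreover have "transpose (C + outer_product x x) = C + outer_product x x"
    by (simp add: transpose_add transpose_outer_product C_def transpose_spectral_matrix)
  ultimately show ?thesis
    using tr by (simp add: barrier_def upd \<mu>_def)
qed

section \<open>Truncated moments of an isotropic vector\<close>

text \<open>Huber's function: \<open>t\<^sup>2\<close> up to \<open>a\<close> and its tangent \<open>2 a t - a\<^sup>2\<close> beyond. It is needed because
  \<open>t * min t a\<close>, whose expectation defines \<open>upper_trunc\<close>, is not convex, so that Jensen's inequality
  does not apply to it.\<close>

definition huber :: "real \<Rightarrow> real \<Rightarrow> real" where
  "huber a t = 2 * min t a * t - (min t a)\<^sup>2"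

text \<open>Huber's function is the supremum of these lines; this is the form in which its convexity is used.\<close>
lemma huber_tangent: "m \<le> a \<Longrightarrow> 2 * m * t - m\<^sup>2 \<le> huber a t"
proof -
  assume m: "m \<le> a"
  have "huber a t - (2 * m * t - m\<^sup>2) = (min t a - m) * (2 * t - min t a - m)"
    by (simp add: huber_def power2_eq_square algebra_simps)
  also have "\<dots> \<ge> 0"
  proof (cases "t \<le> a")
    case True
    then show ?thesis by (simp flip: power2_eq_square)
  next
    case False
    then show ?thesis using m by (intro mult_nonneg_nonneg) auto
  qed
  finally show ?thesis by simp
qed

lemma min_squared_le_huber: "(min t a)\<^sup>2 \<le> huber a t"
  if "0 \<le> t" "0 \<le> a" for t a :: real
  using that mult_right_mono[of "min t a" t "min t a"] by (simp add: huber_def power2_eq_square mult_ac)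

lemma huber_le_mult_min: "huber a t \<le> 2 * (t * min t a)"
  by (simp add: huber_def)

lemma huber_le_mult_min_double:
  assumes "0 \<le> t" "0 \<le> a"
  shows "huber a t \<le> t * min t (2 * a)"
proof -
  have "0 \<le> (t - a)\<^sup>2" by simp
  then show ?thesis
    using assms by (auto simp: huber_def min_def power2_eq_square algebra_simps)
qed

text \<open>Young's inequality for a product in which one factor is truncated: the tangent inequality at
  \<open>m = min t a\<close>, evaluated at \<open>u\<close>.\<close>
lemma mult_min_le_huber:
  assumes "0 \<le> t" "0 \<le> u" "0 \<le> a"
  shows "min t a * u \<le> (huber a t + huber a u) / 2"
  using huber_tangent[of "min t a" a u] min_squared_le_huber[of t a] assms by simp

context prob_space
begin

context
  fixes X :: "'a \<Rightarrow> real^'p"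
  assumes X[measurable]: "X \<in> borel_measurable M" and iso: "isotropic M X"
begin

lemma isotropic_square_moment:
  shows "integrable M (\<lambda>\<omega>. (X \<omega> \<bullet> v)\<^sup>2)" and "(\<integral>\<omega>. (X \<omega> \<bullet> v)\<^sup>2 \<partial>M) = (norm v)\<^sup>2"
proof -
  have "linear (\<lambda>A. v \<bullet> (A *v v))"
    by (rule linearI) (auto simp: matrix_vector_mult_add_rdistrib inner_add_right
        scaleR_matrix_vector_assoc[symmetric])
  then have L: "bounded_linear (\<lambda>A. v \<bullet> (A *v v))" by (simp add: linear_conv_bounded_linear)
  from integrable_bounded_linear[OF L, of M "\<lambda>\<omega>. outer_product (X \<omega>) (X \<omega>)"] iso
  show "integrable M (\<lambda>\<omega>. (X \<omega> \<bullet> v)\<^sup>2)"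
    by (simp add: isotropic_def inner_outer_product_mult_vec)
  from integral_bounded_linear[OF L] iso
  show "(\<integral>\<omega>. (X \<omega> \<bullet> v)\<^sup>2 \<partial>M) = (norm v)\<^sup>2"
    by (fastforce simp: isotropic_def inner_outer_product_mult_vec power2_norm_eq_inner)
qed

lemma integrable_mult_min:
  assumes "0 \<le> a"
  shows "integrable M (\<lambda>\<omega>. (X \<omega> \<bullet> v)\<^sup>2 * min ((X \<omega> \<bullet> v)\<^sup>2) a)"
proof (rule Bochner_Integration.integrable_bound)
  show "integrable M (\<lambda>\<omega>. (X \<omega> \<bullet> v)\<^sup>2 * a)"
    using isotropic_square_moment(1) by simp
  show "AE \<omega> in M. norm ((X \<omega> \<bullet> v)\<^sup>2 * min ((X \<omega> \<bullet> v)\<^sup>2) a) \<le> norm ((X \<omega> \<bullet> v)\<^sup>2 * a)"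
    using assms by (intro AE_I2) (auto simp: abs_mult intro!: mult_left_mono)
qed simp

lemma upper_trunc_ge:
  assumes a: "0 \<le> a" and v: "norm v = 1"
  shows "(\<integral>\<omega>. (X \<omega> \<bullet> v)\<^sup>2 * min ((X \<omega> \<bullet> v)\<^sup>2) a \<partial>M) \<le> upper_trunc M X a"
  unfolding upper_trunc_def
proof (rule cSUP_upper)
  show "bdd_above ((\<lambda>v. \<integral>\<omega>. (X \<omega> \<bullet> v)\<^sup>2 * min ((X \<omega> \<bullet> v)\<^sup>2) a \<partial>M) ` {v. norm v = 1})"
  proof (rule bdd_aboveI2)
    fix u :: "real^'p" assume u: "u \<in> {v. norm v = 1}"
    have "(\<integral>\<omega>. (X \<omega> \<bullet> u)\<^sup>2 * min ((X \<omega> \<bullet> u)\<^sup>2) a \<partial>M) \<le> (\<integral>\<omega>. (X \<omega> \<bullet> u)\<^sup>2 * a \<partial>M)"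
      using isotropic_square_moment(1)
      by (intro integral_mono integrable_mult_min[OF a]) (auto intro!: mult_left_mono)
    also have "\<dots> = a" using u by (simp add: isotropic_square_moment(2))
    finally show "(\<integral>\<omega>. (X \<omega> \<bullet> u)\<^sup>2 * min ((X \<omega> \<bullet> u)\<^sup>2) a \<partial>M) \<le> a" .
  qed
qed (use v in simp)

lemma lower_trunc_le:
  assumes a: "0 \<le> a" and v: "norm v = 1"
  shows "lower_trunc M X a \<le> (\<integral>\<omega>. min ((X \<omega> \<bullet> v)\<^sup>2) a \<partial>M)"
  unfolding lower_trunc_def
proof (rule cINF_lower)
  show "bdd_below ((\<lambda>v. \<integral>\<omega>. min ((X \<omega> \<bullet> v)\<^sup>2) a \<partial>M) ` {v. norm v = 1})"
    using a by (intro bdd_belowI2[of _ 0] integral_nonneg_AE) auto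
qed (use v in simp)

text \<open>If the expectation vanished in some direction, the vector would vanish almost surely in that
  direction, against isotropy. The positivity allows normalising by the square root later on.\<close>
lemma upper_trunc_pos:
  assumes a: "0 < a"
  shows "0 < upper_trunc M X a"
proof -
  define v :: "real^'p" where "v = axis undefined 1"
  have v: "norm v = 1" by (simp add: v_def)
  define f where "f \<omega> = (X \<omega> \<bullet> v)\<^sup>2 * min ((X \<omega> \<bullet> v)\<^sup>2) a" for \<omega>
  have f0: "0 \<le> f \<omega>" for \<omega> using a by (simp add: f_def)
  have fi: "integrable M f" unfolding f_def using a by (intro integrable_mult_min) simp
  have "(\<integral>\<omega>. f \<omega> \<partial>M) \<noteq> 0"
  proof
    assume "(\<integral>\<omega>. f \<omega> \<partial>M) = 0"
    then have "AE \<omega> in M. f \<omega> = 0"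
      using integral_nonneg_eq_0_iff_AE[OF fi] f0 by auto
    then have "AE \<omega> in M. (X \<omega> \<bullet> v)\<^sup>2 = 0"
      by (rule eventually_mono) (use a in \<open>auto simp: f_def min_def split: if_splits\<close>)
    then have "(\<integral>\<omega>. (X \<omega> \<bullet> v)\<^sup>2 \<partial>M) = (\<integral>\<omega>. 0 \<partial>M)"
      by (intro integral_cong_AE) auto
    then show False using isotropic_square_moment(2)[of v] v by simp
  qed
  moreover have "0 \<le> (\<integral>\<omega>. f \<omega> \<partial>M)" using f0 by simp
  ultimately have "0 < (\<integral>\<omega>. f \<omega> \<partial>M)" by simp
  also have "\<dots> \<le> upper_trunc M X a"
    unfolding f_def using a v by (intro upper_trunc_ge) auto
  finally show ?thesis .
qed

context
  fixes u :: "'i::finite \<Rightarrow> real^'p" and Q :: "real^'p \<Rightarrow> real"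
  assumes u: "(\<Sum>i\<in>UNIV. (norm (u i))\<^sup>2) = 1" and Q: "\<And>x. Q x = (\<Sum>i\<in>UNIV. (u i \<bullet> x)\<^sup>2)"
begin

text \<open>The weights are the squared lengths of the \<open>u i\<close>; a vanishing \<open>u i\<close> has weight \<open>0\<close> and is paired
  with an arbitrary unit vector.\<close>
lemma energy_convex_combination:
  obtains w and v :: "'i \<Rightarrow> real^'p" where "\<And>i. 0 \<le> w i" "(\<Sum>i\<in>UNIV. w i) = 1" "\<And>i. norm (v i) = 1"
    "\<And>x. Q x = (\<Sum>i\<in>UNIV. w i * (x \<bullet> v i)\<^sup>2)"
proof
  define v where "v i = (if u i = 0 then axis undefined 1 else u i /\<^sub>R norm (u i))" for i
  show "norm (v i) = 1" for i by (simp add: v_def)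
  show "(\<Sum>i\<in>UNIV. (norm (u i))\<^sup>2) = 1" by (rule u)
  have "(u i \<bullet> x)\<^sup>2 = (norm (u i))\<^sup>2 * (x \<bullet> v i)\<^sup>2" for i x
    by (auto simp: v_def power_mult_distrib power_inverse field_simps inner_commute)
  then show "Q x = (\<Sum>i\<in>UNIV. (norm (u i))\<^sup>2 * (x \<bullet> v i)\<^sup>2)" for x by (simp add: Q)
qed simp

lemma energy_nonneg: "0 \<le> Q x"
  by (simp add: Q sum_nonneg)

lemma energy_measurable[measurable]: "Q \<in> borel_measurable borel"
  by (simp add: Q[abs_def])

lemma energy_integrable: "integrable M (\<lambda>\<omega>. Q (X \<omega>))"
  unfolding Q inner_commute[of "u _"] using isotropic_square_moment(1) by simp

lemma huber_energy_integrable: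
  assumes a: "0 \<le> a"
  shows "integrable M (\<lambda>\<omega>. huber a (Q (X \<omega>)))"
proof (rule Bochner_Integration.integrable_bound)
  show "integrable M (\<lambda>\<omega>. 2 * (Q (X \<omega>) * a))" using energy_integrable by simp
  show "(\<lambda>\<omega>. huber a (Q (X \<omega>))) \<in> borel_measurable M" unfolding huber_def by measurable
  show "AE \<omega> in M. norm (huber a (Q (X \<omega>))) \<le> norm (2 * (Q (X \<omega>) * a))"
  proof (rule AE_I2)
    fix \<omega>
    have "0 \<le> huber a (Q (X \<omega>))"
      using min_squared_le_huber[OF energy_nonneg a, of "X \<omega>"] by (meson order_trans zero_le_power2)
    moreover have "huber a (Q (X \<omega>)) \<le> 2 * (Q (X \<omega>) * a)"
      using huber_le_mult_min[of a "Q (X \<omega>)"] mult_left_mono[of "min (Q (X \<omega>)) a" a "Q (X \<omega>)"]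
        energy_nonneg[of "X \<omega>"] by simp
    ultimately show "norm (huber a (Q (X \<omega>))) \<le> norm (2 * (Q (X \<omega>) * a))" by simp
  qed
qed

lemma min_energy_integrable: "0 \<le> a \<Longrightarrow> integrable M (\<lambda>\<omega>. min (Q (X \<omega>)) a)"
  using energy_nonneg by (intro integrable_const_bound[of _ a]) auto

text \<open>Jensen's inequality for the concave function \<open>min _ a\<close>.\<close>
lemma lower_trunc_le_energy:
  assumes a: "0 \<le> a"
  shows "lower_trunc M X a \<le> (\<integral>\<omega>. min (Q (X \<omega>)) a \<partial>M)"
proof -
  obtain w v where w: "\<And>i. 0 \<le> w i" "(\<Sum>i\<in>UNIV. w i) = 1" and v: "\<And>i. norm (v i :: real^'p) = 1"
    and Qw: "\<And>x. Q x = (\<Sum>i\<in>(UNIV::'i set). w i * (x \<bullet> v i)\<^sup>2)"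
    by (rule energy_convex_combination) blast
  have int: "integrable M (\<lambda>\<omega>. min ((X \<omega> \<bullet> z)\<^sup>2) a)" for z
    using a by (intro integrable_const_bound[of _ a]) auto
  have "lower_trunc M X a = (\<Sum>i\<in>(UNIV::'i set). w i * lower_trunc M X a)"
    by (simp add: sum_distrib_right[symmetric] w)
  also have "\<dots> \<le> (\<Sum>i\<in>UNIV. w i * (\<integral>\<omega>. min ((X \<omega> \<bullet> v i)\<^sup>2) a \<partial>M))"
    using w v a by (intro sum_mono mult_left_mono lower_trunc_le) auto
  also have "\<dots> = (\<integral>\<omega>. (\<Sum>i\<in>UNIV. w i * min ((X \<omega> \<bullet> v i)\<^sup>2) a) \<partial>M)"
    using int by simp
  also have "\<dots> \<le> (\<integral>\<omega>. min (Q (X \<omega>)) a \<partial>M)"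
  proof (rule integral_mono)
    fix \<omega>
    have "(\<Sum>i\<in>UNIV. w i * min ((X \<omega> \<bullet> v i)\<^sup>2) a) \<le> Q (X \<omega>)"
      unfolding Qw using w by (intro sum_mono mult_left_mono) auto
    moreover have "(\<Sum>i\<in>UNIV. w i * min ((X \<omega> \<bullet> v i)\<^sup>2) a) \<le> (\<Sum>i\<in>UNIV. w i * a)"
      using w by (intro sum_mono mult_left_mono) auto
    ultimately show "(\<Sum>i\<in>UNIV. w i * min ((X \<omega> \<bullet> v i)\<^sup>2) a) \<le> min (Q (X \<omega>)) a"
      by (simp add: sum_distrib_right[symmetric] w)
  qed (use int a min_energy_integrable in auto)
  finally show ?thesis .
qed

text \<open>Jensen's inequality for Huber's function, followed by either of its two upper bounds.\<close>
lemma huber_energy_le: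
  assumes a: "0 \<le> a"
  shows "(\<integral>\<omega>. huber a (Q (X \<omega>)) \<partial>M) \<le> 2 * upper_trunc M X a"
    and "(\<integral>\<omega>. huber a (Q (X \<omega>)) \<partial>M) \<le> upper_trunc M X (2 * a)"
proof -
  obtain w v where w: "\<And>i. 0 \<le> w i" "(\<Sum>i\<in>UNIV. w i) = 1" and v: "\<And>i. norm (v i :: real^'p) = 1"
    and Qw: "\<And>x. Q x = (\<Sum>i\<in>(UNIV::'i set). w i * (x \<bullet> v i)\<^sup>2)"
    by (rule energy_convex_combination) blast
  have bound: "(\<integral>\<omega>. huber a (Q (X \<omega>)) \<partial>M) \<le> c * upper_trunc M X b"
    if le: "\<And>t. 0 \<le> t \<Longrightarrow> huber a t \<le> c * (t * min t b)" and b: "0 \<le> b" "0 \<le> c" for b c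
  proof -
    have int: "integrable M (\<lambda>\<omega>. c * ((X \<omega> \<bullet> z)\<^sup>2 * min ((X \<omega> \<bullet> z)\<^sup>2) b))" for z
      using integrable_mult_min[OF b(1)] by simp
    have "huber a (Q x) \<le> (\<Sum>i\<in>UNIV. w i * (c * ((x \<bullet> v i)\<^sup>2 * min ((x \<bullet> v i)\<^sup>2) b)))" for x
    proof -
      define m where "m = min (Q x) a"
      have "huber a (Q x) = 2 * m * (\<Sum>i\<in>UNIV. w i * (x \<bullet> v i)\<^sup>2) - m\<^sup>2 * (\<Sum>i\<in>UNIV. w i)"
        by (simp add: huber_def m_def Qw[symmetric] w)
      also have "\<dots> = (\<Sum>i\<in>UNIV. w i * (2 * m * (x \<bullet> v i)\<^sup>2 - m\<^sup>2))"
        by (simp add: sum_distrib_left sum_distrib_right sum_subtractf right_diff_distrib mult_ac)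
      also have "\<dots> \<le> (\<Sum>i\<in>UNIV. w i * (c * ((x \<bullet> v i)\<^sup>2 * min ((x \<bullet> v i)\<^sup>2) b)))"
        using w(1) by (intro sum_mono mult_left_mono order_trans[OF huber_tangent[of m a] le]) (auto simp: m_def)
      finally show ?thesis .
    qed
    then have "(\<integral>\<omega>. huber a (Q (X \<omega>)) \<partial>M)
       \<le> (\<integral>\<omega>. (\<Sum>i\<in>UNIV. w i * (c * ((X \<omega> \<bullet> v i)\<^sup>2 * min ((X \<omega> \<bullet> v i)\<^sup>2) b))) \<partial>M)"
      using int huber_energy_integrable[OF a] by (intro integral_mono) auto
    also have "\<dots> = (\<Sum>i\<in>UNIV. w i * (c * (\<integral>\<omega>. (X \<omega> \<bullet> v i)\<^sup>2 * min ((X \<omega> \<bullet> v i)\<^sup>2) b \<partial>M)))"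
      using int integrable_mult_min[OF b(1)] by simp
    also have "\<dots> \<le> (\<Sum>i\<in>UNIV. w i * (c * upper_trunc M X b))"
      using w v b by (intro sum_mono mult_left_mono upper_trunc_ge) auto
    also have "\<dots> = c * upper_trunc M X b"
      by (simp add: sum_distrib_right[symmetric] w)
    finally show ?thesis .
  qed
  show "(\<integral>\<omega>. huber a (Q (X \<omega>)) \<partial>M) \<le> 2 * upper_trunc M X a"
    using a by (intro bound huber_le_mult_min) auto
  show "(\<integral>\<omega>. huber a (Q (X \<omega>)) \<partial>M) \<le> upper_trunc M X (2 * a)"
    using a bound[of 1 "2 * a"] huber_le_mult_min_double by simp
qed

end

text \<open>Young's inequality separates the two energies, although they are built from different directions and
  are dependent.\<close>
lemma min_energy_product_le:
  fixes u :: "'i::finite \<Rightarrow> real^'p" and u' :: "'j::finite \<Rightarrow> real^'p"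
  assumes u: "(\<Sum>i\<in>UNIV. (norm (u i))\<^sup>2) = 1" and Q: "\<And>x. Q x = (\<Sum>i\<in>UNIV. (u i \<bullet> x)\<^sup>2)"
    and u': "(\<Sum>i\<in>UNIV. (norm (u' i))\<^sup>2) = 1" and Q': "\<And>x. Q' x = (\<Sum>i\<in>UNIV. (u' i \<bullet> x)\<^sup>2)"
    and a: "0 \<le> a"
  shows "integrable M (\<lambda>\<omega>. min (Q (X \<omega>)) a * Q' (X \<omega>))"
    and "(\<integral>\<omega>. min (Q (X \<omega>)) a * Q' (X \<omega>) \<partial>M) \<le> 2 * upper_trunc M X a"
proof -
  note [measurable] = energy_measurable[OF u Q] energy_measurable[OF u' Q']
  note nonneg = energy_nonneg[OF u Q] energy_nonneg[OF u' Q']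
  show int: "integrable M (\<lambda>\<omega>. min (Q (X \<omega>)) a * Q' (X \<omega>))"
  proof (rule Bochner_Integration.integrable_bound)
    show "integrable M (\<lambda>\<omega>. a * Q' (X \<omega>))" using energy_integrable[OF u' Q'] by simp
    show "AE \<omega> in M. norm (min (Q (X \<omega>)) a * Q' (X \<omega>)) \<le> norm (a * Q' (X \<omega>))"
      using nonneg a by (intro AE_I2) (auto simp: abs_mult intro!: mult_right_mono)
  qed simp
  note h = huber_energy_integrable[OF u Q a] huber_energy_integrable[OF u' Q' a]
  have "(\<integral>\<omega>. min (Q (X \<omega>)) a * Q' (X \<omega>) \<partial>M)
      \<le> (\<integral>\<omega>. (huber a (Q (X \<omega>)) + huber a (Q' (X \<omega>))) / 2 \<partial>M)"
    using int h nonneg a by (intro integral_mono mult_min_le_huber) auto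
  also have "\<dots> = ((\<integral>\<omega>. huber a (Q (X \<omega>)) \<partial>M) + (\<integral>\<omega>. huber a (Q' (X \<omega>)) \<partial>M)) / 2"
    using h by simp
  also have "\<dots> \<le> 2 * upper_trunc M X a"
    using huber_energy_le(1)[OF u Q a] huber_energy_le(1)[OF u' Q' a] by simp
  finally show "(\<integral>\<omega>. min (Q (X \<omega>)) a * Q' (X \<omega>) \<partial>M) \<le> 2 * upper_trunc M X a" .
qed

end
end

section \<open>Moments of the barrier shift\<close>

lemma row_energy_frame:
  fixes G :: "real^'p^'p"
  assumes nz: "(\<Sum>i\<in>UNIV. (norm (row i G))\<^sup>2) \<noteq> 0"
  obtains u :: "'p \<Rightarrow> real^'p" where "(\<Sum>i\<in>UNIV. (norm (u i))\<^sup>2) = 1"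
    "\<And>x. row_energy G x = (\<Sum>i\<in>UNIV. (u i \<bullet> x)\<^sup>2)"
proof
  define U where "U = (\<Sum>i\<in>UNIV. (norm (row i G))\<^sup>2)"
  have U: "0 < U" using nz sum_nonneg[of UNIV "\<lambda>i. (norm (row i G))\<^sup>2"] by (simp add: U_def)
  have "(norm (row i G /\<^sub>R sqrt U))\<^sup>2 = (norm (row i G))\<^sup>2 / U" for i
    using U by (simp add: power_mult_distrib power_inverse divide_inverse)
  then have "(\<Sum>i\<in>UNIV. (norm (row i G /\<^sub>R sqrt U))\<^sup>2) = U / U"
    unfolding U_def by (simp only: sum_divide_distrib)
  then show "(\<Sum>i\<in>UNIV. (norm (row i G /\<^sub>R sqrt U))\<^sup>2) = 1"
    using U by simp
  fix x
  have "(norm (G *v x))\<^sup>2 = (\<Sum>i\<in>UNIV. (row i G \<bullet> x)\<^sup>2)"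
    unfolding power2_norm_eq_inner inner_vec_def[of "G *v x"] matrix_vector_mul_component
    by (simp add: row_def power2_eq_square)
  then have "row_energy G x = (\<Sum>i\<in>UNIV. (row i G \<bullet> x)\<^sup>2 / U)"
    by (simp only: row_energy_def U_def sum_divide_distrib)
  moreover have "((row i G /\<^sub>R sqrt U) \<bullet> x)\<^sup>2 = (row i G \<bullet> x)\<^sup>2 / U" for i
    using U by (simp add: power_mult_distrib power_inverse divide_inverse)
  ultimately show "row_energy G x = (\<Sum>i\<in>UNIV. ((row i G /\<^sub>R sqrt U) \<bullet> x)\<^sup>2)"
    by simp
qed

lemma det_measurable_family:
  fixes A :: "real^'p^'p \<Rightarrow> 'q::finite \<Rightarrow> 'q \<Rightarrow> real"
  assumes "\<And>i j. (\<lambda>B. A B i j) \<in> borel_measurable borel"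
  shows "(\<lambda>B. det (\<chi> i j. A B i j)) \<in> borel_measurable borel"
  using assms unfolding det_def vec_lambda_beta
  by (intro borel_measurable_sum borel_measurable_times borel_measurable_prod borel_measurable_const) auto

lemma matrix_entry_measurable: "(\<lambda>B :: real^'p^'q. B $ i $ j) \<in> borel_measurable borel"
  by (intro borel_measurable_continuous_onI continuous_intros)

lemma cramer_inverse_measurable:
  "(\<lambda>B :: real^'p^'p. cramer_inverse B $ k $ j) \<in> borel_measurable borel"
proof -
  have "(\<lambda>B :: real^'p^'p. if m = k then axis j 1 $ i else B $ i $ m) \<in> borel_measurable borel" for i m
    by (cases "m = k") (simp_all add: matrix_entry_measurable)
  then have "(\<lambda>B :: real^'p^'p. det (\<chi> i m. if m = k then axis j 1 $ i else B $ i $ m)) \<in> borel_measurable borel"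
    using det_measurable_family[of "\<lambda>B i m. if m = k then axis j 1 $ i else B $ i $ m"] by blast
  moreover have "(\<lambda>B :: real^'p^'p. det B) \<in> borel_measurable borel"
    using det_measurable_family[of "\<lambda>B i j. B $ i $ j", OF matrix_entry_measurable]
    unfolding vec_lambda_eta .
  ultimately show ?thesis
    unfolding cramer_inverse_def vec_lambda_beta by (rule borel_measurable_divide)
qed

lemma barrier_shift_measurable:
  "(\<lambda>z :: (real^'p^'p) \<times> (real^'p). barrier_shift \<phi> a (fst z) (snd z)) \<in> borel_measurable (borel \<Otimes>\<^sub>M borel)"
proof -
  let ?N = "borel \<Otimes>\<^sub>M borel :: ((real^'p^'p) \<times> (real^'p)) measure"
  have G: "(\<lambda>z. cramer_inverse (fst z) $ i $ j) \<in> borel_measurable ?N" for i j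
    by (rule measurable_compose[OF measurable_fst cramer_inverse_measurable])
  have "(\<lambda>x :: real^'p. x $ i) \<in> borel_measurable borel" for i
    by (intro borel_measurable_continuous_onI continuous_intros)
  from measurable_compose[OF measurable_snd this]
  have x: "(\<lambda>z. snd z $ i) \<in> borel_measurable ?N" for i .
  have Gx: "(\<lambda>z. (cramer_inverse (fst z) *v snd z) $ i) \<in> borel_measurable ?N" for i
    unfolding matrix_vector_mult_def vec_lambda_beta
    by (intro borel_measurable_sum borel_measurable_times G x)
  have q: "(\<lambda>z. snd z \<bullet> (cramer_inverse (fst z) *v snd z)) \<in> borel_measurable ?N"
    unfolding inner_vec_def inner_real_def by (intro borel_measurable_sum borel_measurable_times Gx x)
  have rows: "(norm (row i (cramer_inverse B)))\<^sup>2 = (\<Sum>j\<in>UNIV. cramer_inverse B $ i $ j * cramer_inverse B $ i $ j)"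
    for i and B :: "real^'p^'p"
    unfolding power2_norm_eq_inner inner_vec_def inner_real_def row_def vec_lambda_beta ..
  have energy: "(\<lambda>z. row_energy (cramer_inverse (fst z)) (snd z)) \<in> borel_measurable ?N"
    unfolding row_energy_def rows power2_norm_eq_inner[of "_ *v _"] inner_vec_def inner_real_def
    by (intro borel_measurable_divide borel_measurable_sum borel_measurable_times Gx G)
  show ?thesis
    unfolding barrier_shift_def Let_def
    by (intro borel_measurable_max borel_measurable_min borel_measurable_times borel_measurable_diff
        borel_measurable_abs borel_measurable_const q energy)
qed

lemma barrier_update_measurable:
  "(\<lambda>z :: (real^'p^'p) \<times> (real^'p). barrier_update \<phi> a (fst z) (snd z)) \<in> measurable (borel \<Otimes>\<^sub>M borel) borel"
proof -
  have "(\<lambda>x :: real^'p. outer_product x x) \<in> borel_measurable borel"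
    unfolding outer_product_def
    by (rule borel_measurable_continuous_onI, rule continuous_on_vec_lambda, rule continuous_on_vec_lambda,
        rule continuous_on_mult) (rule continuous_on_component, rule continuous_on_id)+
  then have "(\<lambda>z :: (real^'p^'p) \<times> (real^'p). outer_product (snd z) (snd z)) \<in> borel_measurable (borel \<Otimes>\<^sub>M borel)"
    by (rule measurable_compose[OF measurable_snd])
  then show ?thesis
    unfolding barrier_update_def
    by (rule borel_measurable_add[OF borel_measurable_diff[OF measurable_fst
          borel_measurable_scaleR[OF barrier_shift_measurable borel_measurable_const]]])
qed

lemma barrier_shift_section_measurable:
  fixes B :: "real^'p^'p"
  shows "barrier_shift \<phi> a B \<in> borel_measurable borel"
proof -
  have "B \<in> space borel" by (simp only: space_borel UNIV_I)
  then have "Pair B \<in> measurable (borel :: (real^'p) measure) (borel \<Otimes>\<^sub>M borel)"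
    by (rule measurable_Pair1')
  from measurable_compose[OF this barrier_shift_measurable]
  show ?thesis unfolding fst_conv snd_conv .
qed

lemma barrier_shift_ge:
  "min (row_energy (cramer_inverse B) x) a
     * (1 - \<phi> * min (row_energy (cramer_inverse B) x) a - \<bar>x \<bullet> (cramer_inverse B *v x)\<bar>)
    \<le> barrier_shift \<phi> a B x"
  by (simp add: barrier_shift_def Let_def)

context prob_space
begin

context
  fixes X :: "'a \<Rightarrow> real^'p"
  assumes X[measurable]: "X \<in> borel_measurable M" and iso: "isotropic M X"
begin

lemma barrier_shift_integrable:
  assumes "0 \<le> \<phi>" "0 \<le> a"
  shows "integrable M (\<lambda>\<omega>. barrier_shift \<phi> a B (X \<omega>))"
    and "integrable M (\<lambda>\<omega>. (barrier_shift \<phi> a B (X \<omega>))\<^sup>2)"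
proof -
  have m: "(\<lambda>\<omega>. barrier_shift \<phi> a B (X \<omega>)) \<in> borel_measurable M"
    by (rule measurable_compose[OF X barrier_shift_section_measurable])
  have b: "0 \<le> barrier_shift \<phi> a B x" "barrier_shift \<phi> a B x \<le> a" for x
    using barrier_shift_nonneg[of \<phi> a B x] barrier_shift_le[OF assms, of B x] by simp_all
  show "integrable M (\<lambda>\<omega>. barrier_shift \<phi> a B (X \<omega>))"
    using b by (intro integrable_const_bound[OF _ m, of a] AE_I2) simp
  have "norm ((barrier_shift \<phi> a B x)\<^sup>2) \<le> a\<^sup>2" for x
    using power_mono[OF b(2) b(1), of x 2] by simp
  then show "integrable M (\<lambda>\<omega>. (barrier_shift \<phi> a B (X \<omega>))\<^sup>2)"
    by (intro integrable_const_bound[OF AE_I2 borel_measurable_power[OF m]])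
qed

text \<open>The shift is at most the truncated energy, whose square is below Huber's function of the energy.
  The rows of the inverse represent the energy as a convex combination of squares without recourse to
  the spectral theorem, hence uniformly over all \<open>B\<close>; a vanishing inverse gives a vanishing shift.\<close>
lemma barrier_shift_second_moment:
  assumes \<phi>: "0 \<le> \<phi>" and a: "0 < a"
  shows "(\<integral>\<omega>. (barrier_shift \<phi> a B (X \<omega>))\<^sup>2 \<partial>M) \<le> upper_trunc M X (2 * a)"
proof (cases "(\<Sum>i\<in>UNIV. (norm (row i (cramer_inverse B)))\<^sup>2) = 0")
  case True
  then have "row_energy (cramer_inverse B) x = 0" for x by (simp add: row_energy_def)
  then have "barrier_shift \<phi> a B x = 0" for x
    using barrier_shift_le[OF \<phi>, of a B x] barrier_shift_nonneg[of \<phi> a B x] a by simp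
  then show ?thesis using upper_trunc_pos[OF X iso, of "2 * a"] a by simp
next
  case False
  then obtain u :: "'p \<Rightarrow> real^'p" where u: "(\<Sum>i\<in>UNIV. (norm (u i))\<^sup>2) = 1"
    "\<And>x. row_energy (cramer_inverse B) x = (\<Sum>i\<in>UNIV. (u i \<bullet> x)\<^sup>2)"
    by (rule row_energy_frame) blast
  define Q where "Q = row_energy (cramer_inverse B)"
  have a0: "0 \<le> a" using a by simp
  note uQ = u(1) u(2)[folded Q_def]
  have "(\<integral>\<omega>. (barrier_shift \<phi> a B (X \<omega>))\<^sup>2 \<partial>M) \<le> (\<integral>\<omega>. huber a (Q (X \<omega>)) \<partial>M)"
  proof (rule integral_mono)
    fix \<omega>
    have "(barrier_shift \<phi> a B (X \<omega>))\<^sup>2 \<le> (min (Q (X \<omega>)) a)\<^sup>2"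
      unfolding Q_def by (intro power_mono barrier_shift_le barrier_shift_nonneg \<phi> a0)
    also have "\<dots> \<le> huber a (Q (X \<omega>))"
      using a0 by (intro min_squared_le_huber) (simp_all add: Q_def row_energy_nonneg)
    finally show "(barrier_shift \<phi> a B (X \<omega>))\<^sup>2 \<le> huber a (Q (X \<omega>))" .
  qed (intro barrier_shift_integrable \<phi> a0 huber_energy_integrable[OF X iso uQ a0])+
  also have "\<dots> \<le> upper_trunc M X (2 * a)"
    by (rule huber_energy_le(2)[OF X iso uQ a0])
  finally show ?thesis .
qed

text \<open>Besides the energy, the form \<open>x\<^sup>T G x\<close> has to be written as a multiple of a convex combination
  of squares: the directions are the eigenvectors of \<open>G\<close>, the total weight is \<open>tr G \<le> \<phi>\<close>. The two
  quadratic losses \<open>\<phi> t\<^sup>2\<close> and \<open>t x\<^sup>T G x\<close> cost \<open>2 \<phi> C\<^sub>p(a)\<close> each.\<close>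
lemma barrier_shift_mean:
  fixes B :: "real^'p^'p"
  assumes B: "barrier \<phi> B" and a: "0 < a"
  shows "lower_trunc M X a - 4 * \<phi> * upper_trunc M X a \<le> (\<integral>\<omega>. barrier_shift \<phi> a B (X \<omega>) \<partial>M)"
proof -
  obtain e l where e: "orthonormal_frame e" and l: "\<And>i. 0 < l i"
    and G: "cramer_inverse B = spectral_matrix e (\<lambda>i. 1 / l i)"
    and tr: "(\<Sum>i\<in>UNIV. 1 / l i) \<le> \<phi>"
    using barrier_spectral[OF B] by blast
  define Q where "Q = row_energy (cramer_inverse B)"
  define \<rho> where "\<rho> = (\<Sum>i\<in>UNIV. 1 / l i)"
  define u' where "u' i = sqrt (1 / (l i * \<rho>)) *\<^sub>R e i" for i
  define Q' where "Q' x = (\<Sum>i\<in>UNIV. (u' i \<bullet> x)\<^sup>2)" for x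
  have \<rho>: "0 < \<rho>" unfolding \<rho>_def using l by (intro sum_pos) auto
  have \<phi>: "0 \<le> \<phi>" using \<rho> tr by (simp add: \<rho>_def)
  have a0: "0 \<le> a" using a by simp
  have ne: "(\<Sum>i\<in>UNIV. (norm (row i (cramer_inverse B)))\<^sup>2) \<noteq> 0"
  proof -
    have "0 < (\<Sum>i\<in>UNIV. (1 / l i)\<^sup>2)" using l by (intro sum_pos) (auto simp: less_imp_neq[symmetric])
    then show ?thesis by (simp add: G sum_norm_rows_spectral_matrix[OF e])
  qed
  obtain u :: "'p \<Rightarrow> real^'p" where u: "(\<Sum>i\<in>UNIV. (norm (u i))\<^sup>2) = 1"
    "\<And>x. Q x = (\<Sum>i\<in>UNIV. (u i \<bullet> x)\<^sup>2)"
    using row_energy_frame[OF ne] unfolding Q_def by blast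
  have e1: "norm (e i) = 1" for i using e by (simp add: orthonormal_frame_def norm_eq_1)
  have l\<rho>: "0 < l i * \<rho>" for i using l \<rho> by simp
  have u': "(\<Sum>i\<in>UNIV. (norm (u' i))\<^sup>2) = 1"
  proof -
    have "(\<Sum>i\<in>UNIV. (norm (u' i))\<^sup>2) = (\<Sum>i\<in>UNIV. (1 / l i) * (1 / \<rho>))"
      using less_imp_le[OF l\<rho>] by (intro sum.cong) (simp_all add: u'_def e1 power_mult_distrib)
    also have "\<dots> = 1" using \<rho> unfolding sum_distrib_right[symmetric] \<rho>_def[symmetric] by simp
    finally show ?thesis .
  qed
  have q1: "x \<bullet> (cramer_inverse B *v x) = \<rho> * Q' x" for x
    using less_imp_le[OF l\<rho>] \<rho> unfolding G inner_spectral_matrix Q'_def u'_def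
    by (simp add: sum_distrib_left power_mult_distrib field_simps)
  have Q'0: "0 \<le> Q' x" for x by (simp add: Q'_def sum_nonneg)
  have Q0: "0 \<le> Q x" for x by (simp add: Q_def row_energy_nonneg)
  note uQ = u and uQ' = u' Q'_def
  note int = min_energy_integrable[OF X iso u a0] huber_energy_integrable[OF X iso u a0]
    min_energy_product_le(1)[OF X iso u uQ' a0]
  have "lower_trunc M X a - 4 * \<phi> * upper_trunc M X a
      = lower_trunc M X a - \<phi> * (2 * upper_trunc M X a) - \<phi> * (2 * upper_trunc M X a)" by simp
  also have "\<dots> \<le> (\<integral>\<omega>. min (Q (X \<omega>)) a \<partial>M) - \<phi> * (\<integral>\<omega>. huber a (Q (X \<omega>)) \<partial>M)
      - \<rho> * (\<integral>\<omega>. min (Q (X \<omega>)) a * Q' (X \<omega>) \<partial>M)"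
  proof -
    have "\<rho> * (\<integral>\<omega>. min (Q (X \<omega>)) a * Q' (X \<omega>) \<partial>M) \<le> \<phi> * (2 * upper_trunc M X a)"
      using tr \<rho> upper_trunc_pos[OF X iso a] min_energy_product_le(2)[OF X iso u uQ' a0]
        Q0 Q'0 a0 \<phi> by (intro mult_mono) (auto simp: \<rho>_def)
    moreover have "\<phi> * (\<integral>\<omega>. huber a (Q (X \<omega>)) \<partial>M) \<le> \<phi> * (2 * upper_trunc M X a)"
      using \<phi> by (intro mult_left_mono huber_energy_le(1)[OF X iso u a0])
    ultimately show ?thesis using lower_trunc_le_energy[OF X iso u a0] by linarith
  qed
  also have "\<dots> = (\<integral>\<omega>. min (Q (X \<omega>)) a - \<phi> * huber a (Q (X \<omega>)) - \<rho> * (min (Q (X \<omega>)) a * Q' (X \<omega>)) \<partial>M)"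
    using int by simp
  also have "\<dots> \<le> (\<integral>\<omega>. barrier_shift \<phi> a B (X \<omega>) \<partial>M)"
  proof (rule integral_mono)
    show "integrable M (\<lambda>\<omega>. min (Q (X \<omega>)) a - \<phi> * huber a (Q (X \<omega>)) - \<rho> * (min (Q (X \<omega>)) a * Q' (X \<omega>)))"
      using int by simp
    fix \<omega>
    define x where "x = X \<omega>"
    have "\<phi> * (min (Q x) a)\<^sup>2 \<le> \<phi> * huber a (Q x)"
      using \<phi> by (intro mult_left_mono min_squared_le_huber Q0 a0)
    moreover have "min (Q x) a * (1 - \<phi> * min (Q x) a - \<bar>\<rho> * Q' x\<bar>) \<le> barrier_shift \<phi> a B x"
      using barrier_shift_ge[of B x a \<phi>] unfolding Q_def q1 .
    moreover have "\<bar>\<rho> * Q' x\<bar> = \<rho> * Q' x" using \<rho> Q'0[of x] by simp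
    ultimately show "min (Q (X \<omega>)) a - \<phi> * huber a (Q (X \<omega>)) - \<rho> * (min (Q (X \<omega>)) a * Q' (X \<omega>))
       \<le> barrier_shift \<phi> a B (X \<omega>)"
      unfolding x_def[symmetric] by (simp add: power2_eq_square algebra_simps)
  qed (rule barrier_shift_integrable(1)[OF \<phi> a0])
  finally show ?thesis .
qed

end
end

section \<open>Fluctuations of an adaptively driven sum\<close>

lemma exp_minus_le_quadratic:
  fixes u :: real
  assumes "0 \<le> u"
  shows "exp (- u) \<le> 1 - u + u\<^sup>2 / 2"
proof -
  have "1 - 0 + 0\<^sup>2 / 2 - exp (- 0) \<le> 1 - u + u\<^sup>2 / 2 - exp (- u)"
  proof (rule DERIV_nonneg_imp_nondecreasing[OF assms])
    fix x :: real
    have "((\<lambda>x. 1 - x + x\<^sup>2 / 2 - exp (- x)) has_real_derivative (- 1 + x + exp (- x))) (at x)"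
      by (auto intro!: derivative_eq_intros)
    moreover have "0 \<le> - 1 + x + exp (- x)"
      using exp_ge_add_one_self[of "- x"] by simp
    ultimately show "\<exists>y. ((\<lambda>x. 1 - x + x\<^sup>2 / 2 - exp (- x)) has_real_derivative y) (at x) \<and> 0 \<le> y"
      by blast
  qed
  then show ?thesis by simp
qed

text \<open>For a nonnegative variable the lower tail is governed by the second moment, through the quadratic
  upper bound on \<open>exp (- u)\<close> for \<open>u \<ge> 0\<close> and \<open>1 + u \<le> exp u\<close>. This is why the second moment, and not
  the bound \<open>a\<close>, appears in the exponent.\<close>
lemma (in prob_space) mgf_lower_tail_nonneg:
  fixes Y :: "'a \<Rightarrow> real"
  assumes [measurable]: "Y \<in> borel_measurable M" and Y: "\<And>\<omega>. \<omega> \<in> space M \<Longrightarrow> 0 \<le> Y \<omega>" "\<And>\<omega>. \<omega> \<in> space M \<Longrightarrow> Y \<omega> \<le> a"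
    and V: "expectation (\<lambda>\<omega>. (Y \<omega>)\<^sup>2) \<le> V" and s: "0 \<le> s"
  shows "expectation (\<lambda>\<omega>. exp (- s * (Y \<omega> - expectation Y))) \<le> exp (s\<^sup>2 * V / 2)"
proof -
  define m where "m = expectation Y"
  have Yi: "integrable M Y"
    using Y by (intro integrable_const_bound[of _ a]) auto
  have Y2i: "integrable M (\<lambda>\<omega>. (Y \<omega>)\<^sup>2)"
    using Y by (intro integrable_const_bound[of _ "a\<^sup>2"]) (auto intro!: AE_I2 power_mono)
  have ei: "integrable M (\<lambda>\<omega>. exp (- s * Y \<omega>))"
    using Y s by (intro integrable_const_bound[of _ 1]) auto
  have "expectation (\<lambda>\<omega>. exp (- s * Y \<omega>)) \<le> expectation (\<lambda>\<omega>. 1 - s * Y \<omega> + s\<^sup>2 / 2 * (Y \<omega>)\<^sup>2)"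
    using ei Yi Y2i Y s exp_minus_le_quadratic[of "s * Y _"]
    by (intro integral_mono) (auto simp: power_mult_distrib)
  also have "\<dots> = 1 - s * m + s\<^sup>2 / 2 * expectation (\<lambda>\<omega>. (Y \<omega>)\<^sup>2)"
    using Yi Y2i by (simp add: m_def prob_space)
  also have "\<dots> \<le> 1 + (s\<^sup>2 * V / 2 - s * m)"
    using mult_left_mono[OF V, of "s\<^sup>2 / 2"] by simp
  also have "\<dots> \<le> exp (s\<^sup>2 * V / 2 - s * m)" by (rule exp_ge_add_one_self)
  finally have "exp (s * m) * expectation (\<lambda>\<omega>. exp (- s * Y \<omega>)) \<le> exp (s * m) * exp (s\<^sup>2 * V / 2 - s * m)"
    by (intro mult_left_mono) auto
  moreover have "exp (- s * (Y \<omega> - m)) = exp (s * m) * exp (- s * Y \<omega>)" for \<omega>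
    by (simp add: exp_add[symmetric] algebra_simps)
  then have "expectation (\<lambda>\<omega>. exp (- s * (Y \<omega> - m))) = exp (s * m) * expectation (\<lambda>\<omega>. exp (- s * Y \<omega>))"
    by (simp only: integral_mult_right_zero)
  ultimately show ?thesis
    by (simp add: m_def[symmetric] exp_add[symmetric])
qed

text \<open>Fubini's theorem for two independent variables: the second one may be integrated out first, with the
  first one frozen.\<close>
lemma (in prob_space) expectation_indep_var_iterated:
  fixes g :: "'b \<Rightarrow> 'b \<Rightarrow> real"
  assumes ind: "indep_var S Y K Z" and g[measurable]: "(\<lambda>z. g (fst z) (snd z)) \<in> borel_measurable (S \<Otimes>\<^sub>M K)"
    and bound: "\<And>y z. y \<in> space S \<Longrightarrow> z \<in> space K \<Longrightarrow> \<bar>g y z\<bar> \<le> c"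
  shows "expectation (\<lambda>\<omega>. g (Y \<omega>) (Z \<omega>)) = expectation (\<lambda>\<omega>. \<integral>z. g (Y \<omega>) z \<partial>distr M K Z)"
proof -
  have [measurable]: "Y \<in> measurable M S" "Z \<in> measurable M K"
    using ind by (auto dest: indep_var_rv1 indep_var_rv2)
  interpret Y: prob_space "distr M S Y" by (rule prob_space_distr) simp
  interpret Z: prob_space "distr M K Z" by (rule prob_space_distr) simp
  interpret P: pair_prob_space "distr M S Y" "distr M K Z" ..
  have gP: "integrable (distr M S Y \<Otimes>\<^sub>M distr M K Z) (\<lambda>z. g (fst z) (snd z))"
  proof (rule P.integrable_const_bound[of _ c])
    show "(\<lambda>z. g (fst z) (snd z)) \<in> borel_measurable (distr M S Y \<Otimes>\<^sub>M distr M K Z)"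
      using g by (simp cong: measurable_cong_sets)
  qed (auto simp: space_pair_measure intro!: AE_I2 bound)
  have "expectation (\<lambda>\<omega>. g (Y \<omega>) (Z \<omega>)) = (\<integral>z. g (fst z) (snd z) \<partial>distr M (S \<Otimes>\<^sub>M K) (\<lambda>\<omega>. (Y \<omega>, Z \<omega>)))"
    by (subst integral_distr) auto
  also have "\<dots> = (\<integral>z. g (fst z) (snd z) \<partial>(distr M S Y \<Otimes>\<^sub>M distr M K Z))"
    using ind by (simp add: indep_var_distribution_eq)
  also have "\<dots> = (\<integral>y. (\<integral>z. g y z \<partial>distr M K Z) \<partial>distr M S Y)"
    using P.integral_fst'[OF gP] by simp
  also have "\<dots> = expectation (\<lambda>\<omega>. \<integral>z. g (Y \<omega>) z \<partial>distr M K Z)"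
  proof (rule integral_distr)
    show "(\<lambda>y. \<integral>z. g y z \<partial>distr M K Z) \<in> borel_measurable S"
      using g by (intro Z.borel_measurable_lebesgue_integral) (simp add: case_prod_beta cong: measurable_cong_sets)
  qed simp
  finally show ?thesis .
qed

primrec orbit :: "('s \<Rightarrow> 'x \<Rightarrow> 's) \<Rightarrow> 's \<Rightarrow> (nat \<Rightarrow> 'x) \<Rightarrow> nat \<Rightarrow> 's" where
  "orbit step s0 x 0 = s0"
| "orbit step s0 x (Suc k) = step (orbit step s0 x k) (x k)"

lemma orbit_cong: "(\<And>i. i < k \<Longrightarrow> x i = x' i) \<Longrightarrow> orbit step s0 x k = orbit step s0 x' k"
  by (induction k) auto

text \<open>A state is updated by independent observations with common law \<open>\<nu>\<close>; in state \<open>s\<close> the observation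
  \<open>x\<close> earns the reward \<open>d s x\<close>. The bound \<open>V\<close> on the second moment of the reward holds in every state,
  hence conditionally on the past.\<close>

locale controlled_sequence = prob_space M
  for M :: "'a measure" +
  fixes X :: "nat \<Rightarrow> 'a \<Rightarrow> 'x" and n :: nat and K \<nu> :: "'x measure"
    and S :: "'s measure" and step :: "'s \<Rightarrow> 'x \<Rightarrow> 's" and s0 :: 's
    and d :: "'s \<Rightarrow> 'x \<Rightarrow> real" and a V :: real
  assumes indep: "indep_vars (\<lambda>_. K) X {..<n}"
    and law: "\<And>k. k < n \<Longrightarrow> distr M K (X k) = \<nu>"
    and step: "(\<lambda>z. step (fst z) (snd z)) \<in> measurable (S \<Otimes>\<^sub>M K) S"
    and d: "(\<lambda>z. d (fst z) (snd z)) \<in> borel_measurable (S \<Otimes>\<^sub>M K)"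
    and s0: "s0 \<in> space S"
    and d_nonneg: "\<And>s x. 0 \<le> d s x" and d_le: "\<And>s x. d s x \<le> a"
    and second_moment: "\<And>s. s \<in> space S \<Longrightarrow> (\<integral>x. (d s x)\<^sup>2 \<partial>\<nu>) \<le> V"
    and n_pos: "0 < n" and V_pos: "0 < V"
begin

text \<open>The conditional mean of the next reward, given that the current state is \<open>s\<close>.\<close>

definition drift :: "'s \<Rightarrow> real" where
  "drift s = (\<integral>x. d s x \<partial>\<nu>)"

definition fluctuation :: "(nat \<Rightarrow> 'x) \<Rightarrow> nat \<Rightarrow> real" where
  "fluctuation x k = (\<Sum>j<k. d (orbit step s0 x j) (x j) - drift (orbit step s0 x j))"

lemma X_measurable[measurable]: "k < n \<Longrightarrow> X k \<in> measurable M K"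
  using indep by (auto simp: indep_vars_def)

lemma sets_law[measurable_cong]: "sets \<nu> = sets K"
  using law[OF n_pos] by (metis sets_distr)

lemma prob_space_law: "prob_space \<nu>"
  using law[OF n_pos] prob_space_distr[OF X_measurable[OF n_pos]] by simp

lemma d_section[measurable]: "s \<in> space S \<Longrightarrow> d s \<in> borel_measurable K"
  using measurable_compose[OF measurable_Pair1' d, of s] by simp

lemma drift_measurable[measurable]: "drift \<in> borel_measurable S"
proof -
  interpret \<nu>: prob_space \<nu> by (rule prob_space_law)
  have "(\<lambda>(s, x). d s x) \<in> borel_measurable (S \<Otimes>\<^sub>M \<nu>)"
    using d by (simp add: case_prod_beta cong: measurable_cong_sets)
  then show ?thesis
    unfolding drift_def by (rule \<nu>.borel_measurable_lebesgue_integral)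
qed

lemma drift_bounds: "0 \<le> drift s" "s \<in> space S \<Longrightarrow> drift s \<le> a"
proof -
  interpret \<nu>: prob_space \<nu> by (rule prob_space_law)
  show "0 \<le> drift s" unfolding drift_def using d_nonneg by simp
  assume s: "s \<in> space S"
  have "(\<integral>x. d s x \<partial>\<nu>) \<le> (\<integral>x. a \<partial>\<nu>)"
    using d_nonneg d_le d_section[OF s] order_trans[OF d_nonneg d_le]
    by (intro integral_mono \<nu>.integrable_const_bound[of _ a]) auto
  then show "drift s \<le> a" by (simp add: drift_def \<nu>.prob_space)
qed

lemma orbit_measurable:
  "k \<le> m \<Longrightarrow> (\<lambda>x. orbit step s0 x k) \<in> measurable (PiM {..<m} (\<lambda>_. K)) S"
proof (induction k)
  case (Suc k)
  then have [measurable]: "(\<lambda>x. orbit step s0 x k) \<in> measurable (PiM {..<m} (\<lambda>_. K)) S"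
    "(\<lambda>x. x k) \<in> measurable (PiM {..<m} (\<lambda>_. K)) K"
    by (auto intro: measurable_component_singleton)
  from measurable_compose[OF _ step, of "\<lambda>x. (orbit step s0 x k, x k)"] show ?case by simp
qed (use s0 in simp)

lemma fluctuation_measurable:
  assumes "k \<le> m"
  shows "(\<lambda>x. fluctuation x k) \<in> borel_measurable (PiM {..<m} (\<lambda>_. K))"
proof -
  have "(\<lambda>x. d (orbit step s0 x j) (x j)) \<in> borel_measurable (PiM {..<m} (\<lambda>_. K))" if "j < k" for j
  proof -
    have [measurable]: "(\<lambda>x. orbit step s0 x j) \<in> measurable (PiM {..<m} (\<lambda>_. K)) S"
      "(\<lambda>x. x j) \<in> measurable (PiM {..<m} (\<lambda>_. K)) K"
      using assms that by (auto intro: measurable_component_singleton orbit_measurable)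
    from measurable_compose[OF _ d, of "\<lambda>x. (orbit step s0 x j, x j)"] show ?thesis by simp
  qed
  moreover have "(\<lambda>x. drift (orbit step s0 x j)) \<in> borel_measurable (PiM {..<m} (\<lambda>_. K))" if "j < k" for j
    using assms that by (intro measurable_compose[OF orbit_measurable drift_measurable]) simp
  ultimately show ?thesis unfolding fluctuation_def by (auto intro!: borel_measurable_sum borel_measurable_diff)
qed

abbreviation history :: "'a \<Rightarrow> nat \<Rightarrow> 'x" where
  "history \<omega> \<equiv> \<lambda>i. X i \<omega>"

lemma orbit_restrict: "orbit step s0 (restrict x {..<k}) k = orbit step s0 x k"
  by (rule orbit_cong) simp

lemma fluctuation_restrict: "fluctuation (restrict x {..<k}) k = fluctuation x k"
  unfolding fluctuation_def
  by (intro sum.cong refl arg_cong2[where f = "(-)"] arg_cong2[where f = d] arg_cong[where f = drift] orbit_cong) auto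

lemma history_measurable: "k \<le> n \<Longrightarrow> (\<lambda>\<omega>. restrict (history \<omega>) {..<k}) \<in> measurable M (PiM {..<k} (\<lambda>_. K))"
  by (intro measurable_restrict) auto

lemma past_measurable[measurable]:
  assumes "k \<le> n"
  shows "(\<lambda>\<omega>. orbit step s0 (history \<omega>) k) \<in> measurable M S"
    and "(\<lambda>\<omega>. fluctuation (history \<omega>) k) \<in> borel_measurable M"
  using measurable_compose[OF history_measurable[OF assms] orbit_measurable[of k k]]
    measurable_compose[OF history_measurable[OF assms] fluctuation_measurable[of k k]]
  by (simp_all add: orbit_restrict fluctuation_restrict)

lemma past_space:
  assumes "k \<le> n" "\<omega> \<in> space M"
  shows "orbit step s0 (history \<omega>) k \<in> space S"
  using measurable_space[OF past_measurable(1)] assms by blast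

text \<open>This takes the place of conditioning on the first \<open>k\<close> observations: the state and the
  fluctuation are functions of them, hence independent of the observation with index \<open>k\<close>.\<close>
lemma expectation_past_present:
  fixes W :: "'s \<times> real \<Rightarrow> 'x \<Rightarrow> real"
  assumes k: "k < n" and W: "(\<lambda>z. W (fst z) (snd z)) \<in> borel_measurable ((S \<Otimes>\<^sub>M borel) \<Otimes>\<^sub>M K)"
    and bound: "\<And>p x. p \<in> space (S \<Otimes>\<^sub>M borel) \<Longrightarrow> \<bar>W p x\<bar> \<le> c"
  shows "expectation (\<lambda>\<omega>. W (orbit step s0 (history \<omega>) k, fluctuation (history \<omega>) k) (X k \<omega>)) =
    expectation (\<lambda>\<omega>. \<integral>x. W (orbit step s0 (history \<omega>) k, fluctuation (history \<omega>) k) x \<partial>\<nu>)"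
proof -
  define past where "past x = (orbit step s0 x k, fluctuation x k)" for x
  define g where "g y z = W (past y) (z k)" for y and z :: "nat \<Rightarrow> 'x"
  have past: "past \<in> measurable (PiM {..<k} (\<lambda>_. K)) (S \<Otimes>\<^sub>M borel)"
    unfolding past_def using orbit_measurable[of k k] fluctuation_measurable[of k k] by simp
  have proj: "(\<lambda>z. z k) \<in> measurable (PiM {k} (\<lambda>_. K)) K"
    by (rule measurable_component_singleton) simp
  have gm: "(\<lambda>z. g (fst z) (snd z)) \<in> borel_measurable (PiM {..<k} (\<lambda>_. K) \<Otimes>\<^sub>M PiM {k} (\<lambda>_. K))"
    unfolding g_def
    using measurable_compose[OF measurable_Pair[OF measurable_compose[OF measurable_fst past]
          measurable_compose[OF measurable_snd proj]] W] by simp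
  have ind: "indep_var (PiM {..<k} (\<lambda>_. K)) (\<lambda>\<omega>. restrict (history \<omega>) {..<k})
      (PiM {k} (\<lambda>_. K)) (\<lambda>\<omega>. restrict (history \<omega>) {k})"
    using k by (intro indep_var_restrict[OF indep]) auto
  have gb: "\<bar>g y z\<bar> \<le> c" if "y \<in> space (PiM {..<k} (\<lambda>_. K))" for y z
    unfolding g_def by (intro bound measurable_space[OF past that])
  have inner: "(\<integral>z. g y z \<partial>distr M (PiM {k} (\<lambda>_. K)) (\<lambda>\<omega>. restrict (history \<omega>) {k})) = (\<integral>x. W (past y) x \<partial>\<nu>)"
    if y: "y \<in> space (PiM {..<k} (\<lambda>_. K))" for y
  proof -
    have Wy: "W (past y) \<in> borel_measurable K"
      using measurable_compose[OF measurable_Pair1' W, of "past y"] measurable_space[OF past y] by simp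
    have "(\<integral>z. g y z \<partial>distr M (PiM {k} (\<lambda>_. K)) (\<lambda>\<omega>. restrict (history \<omega>) {k}))
        = expectation (\<lambda>\<omega>. g y (restrict (history \<omega>) {k}))"
    proof (rule integral_distr)
      show "(\<lambda>\<omega>. restrict (history \<omega>) {k}) \<in> measurable M (PiM {k} (\<lambda>_. K))"
        using k by (intro measurable_restrict) auto
      show "g y \<in> borel_measurable (PiM {k} (\<lambda>_. K))"
        unfolding g_def by (rule measurable_compose[OF proj Wy])
    qed
    also have "\<dots> = expectation (\<lambda>\<omega>. W (past y) (X k \<omega>))" by (simp add: g_def)
    also have "\<dots> = (\<integral>x. W (past y) x \<partial>distr M K (X k))"
      using k Wy by (intro integral_distr[symmetric]) auto
    finally show ?thesis using law[OF k] by simp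
  qed
  have past_eq: "past (restrict x {..<k}) = (orbit step s0 x k, fluctuation x k)" for x
    by (simp add: past_def orbit_restrict fluctuation_restrict)
  have "expectation (\<lambda>\<omega>. W (past (restrict (history \<omega>) {..<k})) (X k \<omega>))
    = expectation (\<lambda>\<omega>. g (restrict (history \<omega>) {..<k}) (restrict (history \<omega>) {k}))"
    by (simp add: g_def)
  also have "\<dots> = expectation (\<lambda>\<omega>. \<integral>z. g (restrict (history \<omega>) {..<k}) z
      \<partial>distr M (PiM {k} (\<lambda>_. K)) (\<lambda>\<omega>. restrict (history \<omega>) {k}))"
    by (rule expectation_indep_var_iterated[OF ind gm gb])
  also have "\<dots> = expectation (\<lambda>\<omega>. \<integral>x. W (past (restrict (history \<omega>) {..<k})) x \<partial>\<nu>)"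
    using k by (intro Bochner_Integration.integral_cong refl inner measurable_space[OF history_measurable]) auto
  finally show ?thesis by (simp only: past_eq)
qed

lemma increment_bound:
  "s \<in> space S \<Longrightarrow> \<bar>d s x - drift s\<bar> \<le> a"
  using d_nonneg[of s x] d_le[of s x] drift_bounds[of s] by linarith

lemma d_present:
  "(\<lambda>z. d (fst (fst z)) (snd z)) \<in> borel_measurable ((S \<Otimes>\<^sub>M (borel :: real measure)) \<Otimes>\<^sub>M K)"
  using measurable_compose[OF _ d, of "\<lambda>z. (fst (fst z), snd z)" "(S \<Otimes>\<^sub>M borel) \<Otimes>\<^sub>M K"] by simp

lemma fluctuation_bound:
  assumes "k \<le> n" "\<omega> \<in> space M"
  shows "\<bar>fluctuation (history \<omega>) k\<bar> \<le> k * a"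
proof -
  have "\<bar>fluctuation (history \<omega>) k\<bar> \<le> (\<Sum>j<k. a)"
    unfolding fluctuation_def
    using assms by (intro order_trans[OF sum_abs] sum_mono increment_bound past_space) auto
  then show ?thesis by simp
qed

lemma fluctuation_integrable: "k \<le> n \<Longrightarrow> integrable M (\<lambda>\<omega>. fluctuation (history \<omega>) k)"
  using fluctuation_bound by (intro integrable_const_bound[of _ "k * a"]) (auto intro!: AE_I2)

lemma fluctuation_mean: "k \<le> n \<Longrightarrow> expectation (\<lambda>\<omega>. fluctuation (history \<omega>) k) = 0"
proof (induction k)
  case 0
  then show ?case by (simp add: fluctuation_def)
next
  case (Suc k)
  then have k: "k < n" by simp
  interpret \<nu>: prob_space \<nu> by (rule prob_space_law)
  define W where "W s x = d (fst s) x - drift (fst s)" for s :: "'s \<times> real" and x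
  have int: "integrable \<nu> (d s)" if "s \<in> space S" for s
    using d_nonneg d_le d_section[OF that] by (intro \<nu>.integrable_const_bound[of _ a]) auto
  have Wm: "(\<lambda>z. W (fst z) (snd z)) \<in> borel_measurable ((S \<Otimes>\<^sub>M borel) \<Otimes>\<^sub>M K)"
    unfolding W_def by (intro borel_measurable_diff d_present) measurable
  have "expectation (\<lambda>\<omega>. d (orbit step s0 (history \<omega>) k) (X k \<omega>) - drift (orbit step s0 (history \<omega>) k))
    = expectation (\<lambda>\<omega>. \<integral>x. d (orbit step s0 (history \<omega>) k) x - drift (orbit step s0 (history \<omega>) k) \<partial>\<nu>)"
    using expectation_past_present[OF k Wm, of a] increment_bound
    by (simp add: W_def space_pair_measure mem_Times_iff)
  also have "\<dots> = expectation (\<lambda>\<omega>. 0)"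
  proof (rule Bochner_Integration.integral_cong)
    fix \<omega> assume "\<omega> \<in> space M"
    then have "integrable \<nu> (d (orbit step s0 (history \<omega>) k))"
      using k by (intro int past_space) auto
    then show "(\<integral>x. d (orbit step s0 (history \<omega>) k) x - drift (orbit step s0 (history \<omega>) k) \<partial>\<nu>) = 0"
      by (simp add: drift_def \<nu>.prob_space)
  qed simp
  finally have "expectation (\<lambda>\<omega>. fluctuation (history \<omega>) (Suc k) - fluctuation (history \<omega>) k) = 0"
    by (simp add: fluctuation_def)
  then show ?case
    using Suc fluctuation_integrable[of k] fluctuation_integrable[of "Suc k"] by simp
qed

text \<open>Each step multiplies the Laplace transform by at most \<open>exp (s\<^sup>2 V / 2)\<close>: with the past frozen, the
  next increment is a centred nonnegative reward with second moment at most \<open>V\<close>.\<close>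
lemma fluctuation_mgf:
  assumes s: "0 \<le> s"
  shows "k \<le> n \<Longrightarrow> integrable M (\<lambda>\<omega>. exp (- s * fluctuation (history \<omega>) k)) \<and>
     expectation (\<lambda>\<omega>. exp (- s * fluctuation (history \<omega>) k)) \<le> exp (k * (s\<^sup>2 * V / 2))"
proof (induction k)
  case 0
  then show ?case by (simp add: fluctuation_def prob_space)
next
  case (Suc k)
  then have k: "k < n" and IH: "integrable M (\<lambda>\<omega>. exp (- s * fluctuation (history \<omega>) k))"
     "expectation (\<lambda>\<omega>. exp (- s * fluctuation (history \<omega>) k)) \<le> exp (k * (s\<^sup>2 * V / 2))" by auto
  interpret \<nu>: prob_space \<nu> by (rule prob_space_law)
  define B where "B = real n * a"
  define clip where "clip w = max (- B) (min B w)" for w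
  \<comment> \<open>On the sample space the fluctuation stays within \<open>B\<close>; the cut-off makes the integrand bounded
    at every point of the space in which the pair (state, fluctuation) lives.\<close>
  define W where "W p x = exp (- s * clip (snd p)) * exp (- s * (d (fst p) x - drift (fst p)))" for p x
  have a0: "0 \<le> a" using d_nonneg d_le order_trans by blast
  have B0: "0 \<le> B" using a0 by (simp add: B_def)
  have clip: "clip (fluctuation (history \<omega>) k) = fluctuation (history \<omega>) k" if "\<omega> \<in> space M" for \<omega>
  proof -
    have "\<bar>fluctuation (history \<omega>) k\<bar> \<le> k * a" using k that by (intro fluctuation_bound) auto
    also have "\<dots> \<le> B" unfolding B_def using k a0 by (intro mult_right_mono) auto
    finally show ?thesis by (auto simp: clip_def)
  qed
  have Wm: "(\<lambda>z. W (fst z) (snd z)) \<in> borel_measurable ((S \<Otimes>\<^sub>M borel) \<Otimes>\<^sub>M K)"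
  proof -
    note [measurable] = d_present
    show ?thesis unfolding W_def clip_def by measurable
  qed
  have Wb: "\<bar>W p x\<bar> \<le> exp (s * B) * exp (s * a)" if "p \<in> space (S \<Otimes>\<^sub>M borel)" for p x
  proof -
    have "- s * clip (snd p) \<le> s * B"
      using s B0 mult_left_mono[of "- B" "clip (snd p)" s] by (simp add: clip_def)
    moreover have "- a \<le> d (fst p) x - drift (fst p)"
      using increment_bound[of "fst p" x] that by (auto simp: space_pair_measure)
    then have "- s * (d (fst p) x - drift (fst p)) \<le> s * a"
      using s mult_left_mono[of "- a" "d (fst p) x - drift (fst p)" s] by simp
    ultimately show ?thesis unfolding W_def by (simp add: abs_mult mult_mono)
  qed
  have inner: "(\<integral>x. exp (- s * (d t x - drift t)) \<partial>\<nu>) \<le> exp (s\<^sup>2 * V / 2)" if t: "t \<in> space S" for t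
    unfolding drift_def
    using \<nu>.mgf_lower_tail_nonneg[OF _ d_nonneg d_le second_moment[OF t] s] d_section[OF t] by simp
  have fl: "\<bar>exp (- s * fluctuation (history \<omega>) (Suc k))\<bar> \<le> exp (s * (Suc k * a))" if "\<omega> \<in> space M" for \<omega>
  proof -
    have "- (Suc k * a) \<le> fluctuation (history \<omega>) (Suc k)"
      using fluctuation_bound[OF Suc.prems that] by linarith
    then show ?thesis
      using mult_left_mono[of "- (Suc k * a)" "fluctuation (history \<omega>) (Suc k)" s] s by simp
  qed
  have int: "integrable M (\<lambda>\<omega>. exp (- s * fluctuation (history \<omega>) (Suc k)))"
    using fl past_measurable[OF Suc.prems]
    by (intro integrable_const_bound[of _ "exp (s * (Suc k * a))"]) (auto intro!: AE_I2)
  have "expectation (\<lambda>\<omega>. exp (- s * fluctuation (history \<omega>) (Suc k)))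
      = expectation (\<lambda>\<omega>. W (orbit step s0 (history \<omega>) k, fluctuation (history \<omega>) k) (X k \<omega>))"
  proof (intro Bochner_Integration.integral_cong refl)
    fix \<omega> assume "\<omega> \<in> space M"
    note clip[OF this]
    then show "exp (- s * fluctuation (history \<omega>) (Suc k))
        = W (orbit step s0 (history \<omega>) k, fluctuation (history \<omega>) k) (X k \<omega>)"
      by (simp add: W_def exp_add[symmetric] fluctuation_def algebra_simps)
  qed
  also have "\<dots> = expectation (\<lambda>\<omega>. \<integral>x. W (orbit step s0 (history \<omega>) k, fluctuation (history \<omega>) k) x \<partial>\<nu>)"
    by (rule expectation_past_present[OF k Wm Wb])
  also have "\<dots> = expectation (\<lambda>\<omega>. exp (- s * fluctuation (history \<omega>) k) *
        (\<integral>x. exp (- s * (d (orbit step s0 (history \<omega>) k) x - drift (orbit step s0 (history \<omega>) k))) \<partial>\<nu>))"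
    by (intro Bochner_Integration.integral_cong refl) (simp add: W_def clip)
  also have "\<dots> \<le> expectation (\<lambda>\<omega>. exp (- s * fluctuation (history \<omega>) k) * exp (s\<^sup>2 * V / 2))"
    using IH(1) k inner past_space[of k] by (intro integral_mono_AE' AE_I2) (auto intro!: mult_left_mono)
  also have "\<dots> \<le> exp (k * (s\<^sup>2 * V / 2)) * exp (s\<^sup>2 * V / 2)"
    using IH by simp
  also have "\<dots> = exp (Suc k * (s\<^sup>2 * V / 2))"
    by (simp add: exp_add[symmetric] algebra_simps)
  finally show ?case using int by simp
qed

text \<open>Chernoff's bound with the optimal parameter \<open>s = t / sqrt (n V)\<close>.\<close>
lemma fluctuation_lower_tail:
  assumes t: "0 < t"
  shows "measure M {\<omega> \<in> space M. fluctuation (history \<omega>) n / sqrt (n * V) < - t} \<le> exp (- t\<^sup>2 / 2)"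
proof -
  define s where "s = t / sqrt (n * V)"
  have nV: "0 < real n * V" using n_pos V_pos by simp
  have s: "0 \<le> s" using t nV by (simp add: s_def)
  have int: "integrable M (\<lambda>\<omega>. exp (- s * fluctuation (history \<omega>) n))"
    and mgf: "expectation (\<lambda>\<omega>. exp (- s * fluctuation (history \<omega>) n)) \<le> exp (t\<^sup>2 / 2)"
    using fluctuation_mgf[OF s, of n] nV n_pos V_pos by (auto simp: s_def power_divide)
  have "{\<omega> \<in> space M. fluctuation (history \<omega>) n / sqrt (n * V) < - t}
      \<subseteq> {\<omega> \<in> space M. exp (t\<^sup>2) \<le> exp (- s * fluctuation (history \<omega>) n)}"
  proof -
    have "exp (t\<^sup>2) \<le> exp (- s * w)" if "w / sqrt (n * V) < - t" for w
    proof -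
      have "t * t \<le> t * (- (w / sqrt (n * V)))"
        using t that by (intro mult_left_mono) auto
      then show ?thesis by (simp add: s_def power2_eq_square)
    qed
    then show ?thesis by blast
  qed
  then have "measure M {\<omega> \<in> space M. fluctuation (history \<omega>) n / sqrt (n * V) < - t}
     \<le> measure M {\<omega> \<in> space M. exp (t\<^sup>2) \<le> exp (- s * fluctuation (history \<omega>) n)}"
    using past_measurable(2)[of n] by (intro finite_measure_mono) auto
  also have "\<dots> \<le> expectation (\<lambda>\<omega>. exp (- s * fluctuation (history \<omega>) n)) / exp (t\<^sup>2)"
    by (intro integral_Markov_inequality_measure[where A = "{}"] int) auto
  also have "\<dots> \<le> exp (t\<^sup>2 / 2) / exp (t\<^sup>2)"
    using mgf by (intro divide_right_mono) auto
  also have "\<dots> = exp (- t\<^sup>2 / 2)"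
    by (simp add: exp_diff[symmetric])
  finally show ?thesis .
qed

end

section \<open>The bound on the smallest eigenvalue\<close>

lemma barrier_orbit:
  assumes "barrier \<phi> B" "0 < a" "\<phi> * a < 1"
  shows "barrier \<phi> (orbit (barrier_update \<phi> a) B x k)"
  using assms by (induction k) (auto intro: barrier_preserved)

lemma orbit_barrier_update_eq:
  fixes x :: "nat \<Rightarrow> real^'p"
  shows "orbit (barrier_update \<phi> a) B x k = B + (\<Sum>j<k. outer_product (x j) (x j))
     - (\<Sum>j<k. barrier_shift \<phi> a (orbit (barrier_update \<phi> a) B x j) (x j)) *\<^sub>R mat 1"
  by (induction k) (simp_all add: barrier_update_def scaleR_add_left)

text \<open>The final state \<open>A - (D - c) I\<close>, with \<open>D\<close> the sum of the shifts, is positive definite, so \<open>D - c\<close> lies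
  below the spectrum of \<open>A\<close>.\<close>
lemma smallest_eigenvalue_ge_shifts:
  fixes x :: "nat \<Rightarrow> real^'p"
  assumes a: "0 < a" "\<phi> * a < 1" and c: "0 < c" "real CARD('p) / c = \<phi>" and n: "0 < n"
  defines "A \<equiv> (\<Sum>j<n. outer_product (x j) (x j))"
  shows "((\<Sum>j<n. barrier_shift \<phi> a (orbit (barrier_update \<phi> a) (c *\<^sub>R mat 1) x j) (x j)) - c) / real n
    \<le> smallest_eigenvalue ((1 / real n) *\<^sub>R A)"
proof (rule smallest_eigenvalue_ge)
  define D where "D = (\<Sum>j<n. barrier_shift \<phi> a (orbit (barrier_update \<phi> a) (c *\<^sub>R mat 1) x j) (x j))"
  define B where "B = orbit (barrier_update \<phi> a) (c *\<^sub>R mat 1) x n"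
  have bar: "barrier \<phi> B"
    unfolding B_def c(2)[symmetric] using a c by (intro barrier_orbit barrier_scaled_identity) auto
  have A: "A = B + (D - c) *\<^sub>R mat 1"
    unfolding A_def B_def D_def orbit_barrier_update_eq[of _ _ _ _ n] by (simp add: scaleR_diff_left)
  have "transpose A = A"
    using bar by (simp add: A transpose_add transpose_scalar barrier_def)
  then show "transpose ((1 / real n) *\<^sub>R A) = (1 / real n) *\<^sub>R A" by (simp add: transpose_scalar)
  fix v :: "real^'p"
  have "0 \<le> v \<bullet> (B *v v)"
    using bar by (cases "v = 0") (auto simp: barrier_def less_imp_le)
  then have "(D - c) * (v \<bullet> v) \<le> v \<bullet> (A *v v)"
    by (simp add: A matrix_vector_mult_add_rdistrib inner_add_right scaleR_matrix_vector_assoc[symmetric])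
  then show "(D - c) / real n * (v \<bullet> v) \<le> v \<bullet> (((1 / real n) *\<^sub>R A) *v v)"
    using n by (simp add: scaleR_matrix_vector_assoc[symmetric] divide_right_mono)
qed

lemma matrix_mult_transpose_eq_sum_outer_product:
  fixes A :: "real^'n^'p"
  shows "A ** transpose A = (\<Sum>k\<in>UNIV. outer_product (column k A) (column k A))"
  by (simp add: vec_eq_iff matrix_matrix_mult_def transpose_def outer_product_def column_def)

lemma (in prob_space) indep_vars_reindex_inj:
  assumes ind: "indep_vars (\<lambda>_. K) Y UNIV" and f: "inj_on f I"
  shows "indep_vars (\<lambda>_. K) (\<lambda>i. Y (f i)) I"
proof -
  \<comment> \<open>Restriction to the disjoint singletons \<open>{f i}\<close> changes the index set to \<open>I\<close>.\<close>
  have "indep_vars (\<lambda>i. PiM {f i} (\<lambda>_. K)) (\<lambda>i \<omega>. restrict (\<lambda>k. Y k \<omega>) {f i}) I"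
    using f by (intro indep_vars_restrict[OF ind]) (auto simp: disjoint_family_on_def inj_on_def)
  from indep_vars_compose2[OF this, of "\<lambda>i z. z (f i)" "\<lambda>_. K"] show ?thesis
    by (simp add: measurable_component_singleton)
qed

theorem theorem2p1:
  fixes N :: "'b measure" and Xp :: "'b \<Rightarrow> real^'p"
    and M :: "'a measure" and X :: "'a \<Rightarrow> real^'n^'p"
    and y :: real
  assumes "CARD('p) \<le> CARD('n)"
    and "prob_space N" and "Xp \<in> borel_measurable N" and "isotropic N Xp"
    and "0 < y" and "y < 1" and "real CARD('p) / real CARD('n) \<le> y"
    and "prob_space M" and "X \<in> borel_measurable M"
    and "prob_space.indep_vars M (\<lambda>_. borel) (\<lambda>k \<omega>. column k (X \<omega>)) UNIV"
    and "\<And>k. distr M borel (\<lambda>\<omega>. column k (X \<omega>)) = distr N borel Xp"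
  shows "\<forall>a>0. \<exists>Z :: 'a \<Rightarrow> real.
     Z \<in> borel_measurable M \<and> integrable M Z \<and> (\<integral>\<omega>. Z \<omega> \<partial>M) = 0 \<and>
     (\<forall>t>0. measure M {\<omega> \<in> space M. Z \<omega> < - t} \<le> exp (- t\<^sup>2 / 2)) \<and>
     (AE \<omega> in M.
        smallest_eigenvalue ((1 / real CARD('n)) *\<^sub>R (X \<omega> ** transpose (X \<omega>)))
        \<ge> lower_trunc N Xp a - upper_trunc N Xp a / a - 5 * a * y
           + sqrt (upper_trunc N Xp (2 * a)) * Z \<omega> / sqrt (real CARD('n)))"
proof (intro allI impI)
  fix a :: real assume a: "0 < a"
  interpret N: prob_space N by fact
  interpret M: prob_space M by fact
  note iso = assms(3,4)
  define n where "n = CARD('n)"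
  \<comment> \<open>Any level below \<open>1 / a\<close> would keep the barrier valid. This one makes the start
    \<open>c = p / \<phi>\<close> equal to \<open>5 a p\<close>, while the loss \<open>4 \<phi> C\<^sub>p(a)\<close> in the mean stays below \<open>C\<^sub>p(a) / a\<close>.\<close>
  define \<phi> where "\<phi> = 1 / (5 * a)"
  define c where "c = 5 * a * real CARD('p)"
  define V where "V = upper_trunc N Xp (2 * a)"
  have n: "0 < n" by (simp add: n_def)
  have \<phi>: "0 \<le> \<phi>" "\<phi> * a < 1" using a by (simp_all add: \<phi>_def)
  have c: "0 < c" "real CARD('p) / c = \<phi>" using a by (simp_all add: c_def \<phi>_def)
  have initial: "barrier \<phi> (c *\<^sub>R mat 1 :: real^'p^'p)"
    unfolding c(2)[symmetric] by (rule barrier_scaled_identity[OF c(1)])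
  have V: "0 < V" unfolding V_def using a by (intro N.upper_trunc_pos[OF iso]) simp
  obtain f where f: "bij_betw f {..<n} (UNIV :: 'n set)"
    unfolding n_def using ex_bij_betw_nat_finite[OF finite, of "UNIV :: 'n set"] by (auto simp: atLeast0LessThan)
  define Y where "Y k \<omega> = column (f k) (X \<omega>)" for k \<omega>
  have shift_integral: "(\<integral>x. barrier_shift \<phi> a B x \<partial>distr N borel Xp) = (\<integral>\<omega>. barrier_shift \<phi> a B (Xp \<omega>) \<partial>N)"
    "(\<integral>x. (barrier_shift \<phi> a B x)\<^sup>2 \<partial>distr N borel Xp) = (\<integral>\<omega>. (barrier_shift \<phi> a B (Xp \<omega>))\<^sup>2 \<partial>N)" for B
    by (rule integral_distr[OF assms(3)], intro borel_measurable_power barrier_shift_section_measurable)+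
  interpret controlled_sequence M Y n borel "distr N borel Xp" borel "barrier_update \<phi> a" "c *\<^sub>R mat 1"
    "barrier_shift \<phi> a" a V
  proof
    have "M.indep_vars (\<lambda>_. borel) (\<lambda>i \<omega>. column (f i) (X \<omega>)) {..<n}"
      by (rule M.indep_vars_reindex_inj[OF assms(10) bij_betw_imp_inj_on[OF f]])
    then show "M.indep_vars (\<lambda>_. borel) Y {..<n}" by (simp add: Y_def[abs_def])
    show "distr M borel (Y k) = distr N borel Xp" for k
      using assms(11) by (simp add: Y_def[abs_def])
    show "(\<lambda>z. barrier_update \<phi> a (fst z) (snd z)) \<in> measurable (borel \<Otimes>\<^sub>M borel) borel"
      by (rule barrier_update_measurable)
    show "(\<lambda>z. barrier_shift \<phi> a (fst z) (snd z)) \<in> borel_measurable (borel \<Otimes>\<^sub>M borel)"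
      by (rule barrier_shift_measurable)
    show "c *\<^sub>R mat 1 \<in> space borel" by (simp only: space_borel UNIV_I)
    show "0 \<le> barrier_shift \<phi> a s x" for s x by (rule barrier_shift_nonneg)
    show "barrier_shift \<phi> a s x \<le> a" for s x
      using barrier_shift_le[of \<phi> a s x] \<phi>(1) a by simp
    show "(\<integral>x. (barrier_shift \<phi> a s x)\<^sup>2 \<partial>distr N borel Xp) \<le> V" for s
      unfolding shift_integral V_def by (rule N.barrier_shift_second_moment[OF iso \<phi>(1) a])
  qed (fact n V)+
  define W where "W \<omega> = fluctuation (history \<omega>) n" for \<omega>
  define Z where "Z \<omega> = W \<omega> / sqrt (n * V)" for \<omega>
  have W: "integrable M W" "(\<integral>\<omega>. W \<omega> \<partial>M) = 0"
    unfolding W_def by (auto intro: fluctuation_integrable fluctuation_mean)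
  have "integrable M Z" "(\<integral>\<omega>. Z \<omega> \<partial>M) = 0"
    unfolding Z_def using W by simp_all
  moreover have "measure M {\<omega> \<in> space M. Z \<omega> < - t} \<le> exp (- t\<^sup>2 / 2)" if "0 < t" for t
    unfolding Z_def W_def by (rule fluctuation_lower_tail[OF that])
  moreover have "lower_trunc N Xp a - upper_trunc N Xp a / a - 5 * a * y + sqrt V * Z \<omega> / sqrt (real n)
      \<le> smallest_eigenvalue ((1 / real n) *\<^sub>R (X \<omega> ** transpose (X \<omega>)))" for \<omega>
  proof -
    define B where "B j = orbit (barrier_update \<phi> a) (c *\<^sub>R mat 1) (history \<omega>) j" for j
    define m where "m = lower_trunc N Xp a - upper_trunc N Xp a / a"
    have drift: "m \<le> drift (B j)" for j
    proof -
      have "barrier \<phi> (B j)"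
        unfolding B_def by (rule barrier_orbit[OF initial a \<phi>(2)])
      then have "lower_trunc N Xp a - 4 * \<phi> * upper_trunc N Xp a \<le> drift (B j)"
        unfolding drift_def shift_integral using a by (intro N.barrier_shift_mean[OF iso])
      moreover have "4 * \<phi> * upper_trunc N Xp a \<le> upper_trunc N Xp a / a"
        using N.upper_trunc_pos[OF iso a] a by (simp add: \<phi>_def field_simps)
      ultimately show ?thesis by (simp add: m_def)
    qed
    have "real n * m \<le> (\<Sum>j<n. drift (B j))"
      using sum_mono[of "{..<n}" "\<lambda>_. m" "\<lambda>j. drift (B j)"] drift by simp
    then have "W \<omega> + real n * m \<le> (\<Sum>j<n. barrier_shift \<phi> a (B j) (Y j \<omega>))"
      by (simp add: W_def fluctuation_def sum_subtractf B_def)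
    then have "(W \<omega> + real n * m - c) / real n \<le> ((\<Sum>j<n. barrier_shift \<phi> a (B j) (Y j \<omega>)) - c) / real n"
      by (intro divide_right_mono) auto
    also have "\<dots> \<le> smallest_eigenvalue ((1 / real n) *\<^sub>R (\<Sum>j<n. outer_product (Y j \<omega>) (Y j \<omega>)))"
      unfolding B_def by (rule smallest_eigenvalue_ge_shifts[OF a \<phi>(2) c n])
    also have "(\<Sum>j<n. outer_product (Y j \<omega>) (Y j \<omega>)) = X \<omega> ** transpose (X \<omega>)"
      unfolding matrix_mult_transpose_eq_sum_outer_product Y_def
      by (rule sum.reindex_bij_betw[OF f])
    finally have "(W \<omega> + real n * m - c) / real n \<le> smallest_eigenvalue ((1 / real n) *\<^sub>R (X \<omega> ** transpose (X \<omega>)))" .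
    moreover have "(W \<omega> + real n * m - c) / real n = W \<omega> / real n + m - 5 * a * (real CARD('p) / real n)"
      using n by (simp add: c_def field_simps)
    moreover have "5 * a * (real CARD('p) / real n) \<le> 5 * a * y"
      using assms(7) a by (intro mult_left_mono) (auto simp: n_def)
    moreover have "sqrt V * Z \<omega> / sqrt (real n) = W \<omega> / real n"
      using V n by (simp add: Z_def real_sqrt_mult)
    ultimately show ?thesis unfolding m_def by linarith
  qed
  ultimately show "\<exists>Z :: 'a \<Rightarrow> real.
     Z \<in> borel_measurable M \<and> integrable M Z \<and> (\<integral>\<omega>. Z \<omega> \<partial>M) = 0 \<and>
     (\<forall>t>0. measure M {\<omega> \<in> space M. Z \<omega> < - t} \<le> exp (- t\<^sup>2 / 2)) \<and>
     (AE \<omega> in M.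
        smallest_eigenvalue ((1 / real CARD('n)) *\<^sub>R (X \<omega> ** transpose (X \<omega>)))
        \<ge> lower_trunc N Xp a - upper_trunc N Xp a / a - 5 * a * y
           + sqrt (upper_trunc N Xp (2 * a)) * Z \<omega> / sqrt (real CARD('n)))"
    unfolding V_def n_def by (intro exI[of _ Z]) auto
qed

end
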